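(* Let $\mathbf{V}$ be a pseudovariety of finite groups containing all finite nilpotent groups. Let $H$ be a cyclic subgroup of a free group $F$. Then: (i) $H$ is $\mathbf{V}$-closed; (ii) $H$ is a free factor of a $\mathbf{V}$-clopen subgroup of $F$.
   Context: A pseudovariety of finite groups is a class of finite groups closed under taking subgroups, homomorphic images and finitary direct products. The pro-$\mathbf{V}$ topology on a group $G$ is the coarsest topology making all homomorphisms from $G$ into (discrete) members of $\mathbf{V}$ continuous; equivalently, $G$ is a topological group in which the normal subgroups $K$ with $G/K \in \mathbf{V}$ form a basis of neighbourhoods of the identity. "$\mathbf{V}$-closed" and "$\mathbf{V}$-clopen" mean closed, respectively both closed and open, in the pro-$\mathbf{V}$ topology on $F$. *)

theory Defs
  imports "HOL-Analysis.Function_Topology" "HOL-Algebra.Elementary_Groups" "HOL-Algebra.Product_Groups"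
begin

section \<open>Pseudovarieties of finite groups\<close>

text \<open>
  Every finite group has an isomorphic copy whose elements are natural numbers, so a class of
  finite groups (closed under isomorphism) is represented by a set of groups of type
  \<^typ>\<open>nat monoid\<close>. Closure under homomorphic images includes closure under isomorphism; direct
  products are taken up to isomorphism because \<^const>\<open>product_group\<close> changes the element type.
  The empty product is allowed, so the trivial groups belong to every pseudovariety.
\<close>

definition pseudovariety :: "nat monoid set \<Rightarrow> bool" where
  "pseudovariety V \<longleftrightarrow>
     (\<forall>N\<in>V. group N \<and> finite (carrier N)) \<and>
     (\<forall>N\<in>V. \<forall>S. subgroup S N \<longrightarrow> N\<lparr>carrier := S\<rparr> \<in> V) \<and>
     (\<forall>N\<in>V. \<forall>M :: nat monoid. \<forall>f.
        group M \<and> f \<in> hom N M \<and> f ` carrier N = carrier M \<longrightarrow> M \<in> V) \<and>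
     (\<forall>(I :: nat set) N. \<forall>M :: nat monoid.
        finite I \<and> (\<forall>i\<in>I. N i \<in> V) \<and> group M \<and> M \<cong> product_group I N \<longrightarrow> M \<in> V)"

primrec lower_central :: "('a, 'b) monoid_scheme \<Rightarrow> nat \<Rightarrow> 'a set" where
  "lower_central G 0 = carrier G"
| "lower_central G (Suc n) =
     generate G {x \<otimes>\<^bsub>G\<^esub> y \<otimes>\<^bsub>G\<^esub> inv\<^bsub>G\<^esub> x \<otimes>\<^bsub>G\<^esub> inv\<^bsub>G\<^esub> y | x y.
                   x \<in> lower_central G n \<and> y \<in> carrier G}"

definition nilpotent_group :: "('a, 'b) monoid_scheme \<Rightarrow> bool" where
  "nilpotent_group G \<longleftrightarrow> group G \<and> (\<exists>n. lower_central G n = {\<one>\<^bsub>G\<^esub>})"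

section \<open>The pro-V topology\<close>

text \<open>
  The coarsest topology making all homomorphisms into discrete members of \<open>V\<close> continuous; the
  preimages of arbitrary subsets form a subbasis. Its underlying set is the carrier of \<open>G\<close> as
  soon as \<open>V\<close> is nonempty.
\<close>

definition pro_topology :: "nat monoid set \<Rightarrow> ('a, 'b) monoid_scheme \<Rightarrow> 'a topology" where
  "pro_topology V G = topology_generated_by
     {{x \<in> carrier G. \<phi> x \<in> U} | \<phi> N U.
        N \<in> V \<and> \<phi> \<in> hom G N \<and> openin (discrete_topology (carrier N)) U}"

lemma pseudovariety_ex_trivial:
  assumes "pseudovariety V"
  shows "\<exists>N\<in>V. trivial_group N"
proof -
  define M :: "nat monoid" where "M = singleton_group 0"
  have M: "group M" "trivial_group M"
    by (simp_all add: M_def)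
  have "(\<lambda>_. \<lambda>_. undefined) \<in> iso M (product_group {} (\<lambda>_::nat. M))"
    by (auto simp: iso_def hom_def bij_betw_def M_def product_group_def)
  then have "M \<cong> product_group {} (\<lambda>_::nat. M)"
    by (auto simp: is_iso_def)
  moreover have "\<forall>(I :: nat set) N. \<forall>M :: nat monoid.
      finite I \<and> (\<forall>i\<in>I. N i \<in> V) \<and> group M \<and> M \<cong> product_group I N \<longrightarrow> M \<in> V"
    using assms unfolding pseudovariety_def by (elim conjE)
  note this[rule_format, of "{}" "\<lambda>_. M" M]
  ultimately have "M \<in> V"
    using M(1) by simp
  with M show ?thesis by blast
qed

lemma topspace_pro_topology:
  assumes "pseudovariety V" "group G"
  shows "topspace (pro_topology V G) = carrier G"
proof -
  obtain N where N: "N \<in> V" "trivial_group N"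
    using pseudovariety_ex_trivial assms(1) by blast
  then have "group N" by (simp add: trivial_group_def)
  then interpret N: group N .
  let ?S = "{{x \<in> carrier G. \<phi> x \<in> U} | \<phi> N U.
        N \<in> V \<and> \<phi> \<in> hom G N \<and> openin (discrete_topology (carrier N)) U}"
  have hom: "(\<lambda>_. \<one>\<^bsub>N\<^esub>) \<in> hom G N" by (simp add: hom_def)
  have "{x \<in> carrier G. (\<lambda>_. \<one>\<^bsub>N\<^esub>) x \<in> carrier N} \<in> ?S"
    by (rule CollectI, intro exI conjI, rule refl, rule N(1), rule hom) simp
  then have "carrier G \<in> ?S" by simp
  then have "carrier G \<subseteq> \<Union>?S" by (rule Union_upper)
  moreover have "\<Union>?S \<subseteq> carrier G" by auto
  ultimately show ?thesis
    unfolding pro_topology_def topology_generated_by_topspace by (rule equalityI[rotated])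
qed

section \<open>Free groups and free factors\<close>

text \<open>
  A letter \<open>(x, True)\<close> stands for \<open>x\<close> and \<open>(x, False)\<close> for its inverse. The set \<open>X\<close> is a basis of
  \<open>G\<close> iff every element of \<open>G\<close> is the value of exactly one reduced word over \<open>X\<close>.
\<close>

definition reduced_words :: "'a set \<Rightarrow> ('a \<times> bool) list set" where
  "reduced_words X =
     {w. fst ` set w \<subseteq> X \<and> successively (\<lambda>u v. \<not> (fst u = fst v \<and> snd u \<noteq> snd v)) w}"

definition word_value :: "('a, 'b) monoid_scheme \<Rightarrow> ('a \<times> bool) list \<Rightarrow> 'a" where
  "word_value G w =
     foldr (\<lambda>(x, b) g. (if b then x else inv\<^bsub>G\<^esub> x) \<otimes>\<^bsub>G\<^esub> g) w \<one>\<^bsub>G\<^esub>"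

definition free_basis :: "('a, 'b) monoid_scheme \<Rightarrow> 'a set \<Rightarrow> bool" where
  "free_basis G X \<longleftrightarrow>
     X \<subseteq> carrier G \<and> bij_betw (word_value G) (reduced_words X) (carrier G)"

definition free_group :: "('a, 'b) monoid_scheme \<Rightarrow> bool" where
  "free_group G \<longleftrightarrow> group G \<and> (\<exists>X. free_basis G X)"

text \<open>
  \<open>G\<close> is the (internal) free product of \<open>A\<close> and \<open>B\<close> iff every element of \<open>G\<close> is the value of exactly
  one alternating word of nontrivial elements of \<open>A\<close> and \<open>B\<close>. Letters are tagged with the factor
  they come from; without the tags, uniqueness would not force \<open>A\<close> and \<open>B\<close> to meet trivially.
\<close>

definition alternating_words ::
    "('a, 'b) monoid_scheme \<Rightarrow> 'a set \<Rightarrow> 'a set \<Rightarrow> ('a + 'a) list set" where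
  "alternating_words G A B =
     {w. set w \<subseteq> (A - {\<one>\<^bsub>G\<^esub>}) <+> (B - {\<one>\<^bsub>G\<^esub>}) \<and> successively (\<lambda>u v. isl u \<noteq> isl v) w}"

definition tagged_value :: "('a, 'b) monoid_scheme \<Rightarrow> ('a + 'a) list \<Rightarrow> 'a" where
  "tagged_value G w = foldr (\<lambda>u g. case_sum id id u \<otimes>\<^bsub>G\<^esub> g) w \<one>\<^bsub>G\<^esub>"

definition internal_free_product ::
    "('a, 'b) monoid_scheme \<Rightarrow> 'a set \<Rightarrow> 'a set \<Rightarrow> bool" where
  "internal_free_product G A B \<longleftrightarrow>
     subgroup A G \<and> subgroup B G \<and>
     bij_betw (tagged_value G) (alternating_words G A B) (carrier G)"

definition free_factor :: "('a, 'b) monoid_scheme \<Rightarrow> 'a set \<Rightarrow> bool" where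
  "free_factor G A \<longleftrightarrow> (\<exists>B. internal_free_product G A B)"

end

(*
A cyclically reduced word w commutes with a reduced word g only if, after multiplying g by a high
power of w, the two commute as lists; so the centralizer of an element is cyclic. An element outside
<u> either fails to commute with u, or is a power v^m with u = v^i and i not dividing m. In both
cases residual finiteness by p-groups separates it from <u> in a finite nilpotent group; in the
second case p is chosen with p^k dividing i but not m, and the order of v is kept divisible by p^k.
Residual p-finiteness comes from Magnus' unitriangular representation: for g = x_1^e_1 ... x_n^e_n
with adjacent x_i distinct, let x act by v_r |-> v_r + v_(r+1) at the positions r with x_r = x; then
g has the corner entry e_1 ... e_n, which survives modulo a high power of p.

Hence cyclic subgroups are closed. For (ii), choose a basis in which u is a cyclically reduced word
w and a clopen K containing u in which the proper prefixes of w lie in distinct right cosets. In the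
Schreier graph of K the word w then traverses an embedded cycle, so <u> is a free factor of K, the
other factor being the loops that avoid the last edge of this cycle. The freeness is a ping-pong
argument on the reduced words that begin with w or with the inverse of its last letter.
*)
theory Submission
  imports Defs
    "HOL-Library.Sublist"
    "HOL-Algebra.Weak_Morphisms"
    "HOL-Library.Function_Algebras"
    "HOL-Algebra.Bij"
    "HOL-Computational_Algebra.Primes"
    "HOL-Algebra.Multiplicative_Group"
begin

section \<open>Reduced words\<close>

text \<open>The delicate separation is inside a cyclic group: v^m must stay away from all powers of
  v^i at once, while residual finiteness only keeps single elements alive. Keeping the single
  element v^(p^k) alive is nevertheless enough when all orders in the image are powers of p: the
  order of v then does not divide p^k, hence is divisible by p^(k+1), and a power of p^(k+1)
  dividing i but not m decides the question.

  For (ii), the coset condition is an application of (i). If p_i and p_j are different proper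
  prefixes of w, then p_i p_j^-1 is not a power of u, as a comparison of lengths of reduced words
  shows; so some clopen subgroup contains u and omits this element. Only finitely many pairs occur,
  so the intersection is still open.

  The basis is conjugated instead of u, so the subgroup under study never changes. The Schreier
  graph is not constructed: a vertex is a group element s standing for the coset K s, and a path is
  a word read from s.\<close>

definition inv_letter :: "'a \<times> bool \<Rightarrow> 'a \<times> bool" where
  "inv_letter l = (fst l, \<not> snd l)"

definition inv_word :: "('a \<times> bool) list \<Rightarrow> ('a \<times> bool) list" where
  "inv_word w = rev (map inv_letter w)"

lemma inv_letter_simps [simp]:
  "inv_letter (inv_letter l) = l" "fst (inv_letter l) = fst l" "inv_letter l \<noteq> l"
  "snd (inv_letter l) \<longleftrightarrow> \<not> snd l"
  by (auto simp: inv_letter_def prod_eq_iff)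

lemma inv_letter_eq_iff: "inv_letter k = l \<longleftrightarrow> k = inv_letter l"
  by (auto simp: inv_letter_def prod_eq_iff)

lemma inv_word_simps [simp]:
  "inv_word [] = []" "inv_word (a @ b) = inv_word b @ inv_word a"
  "inv_word (l # w) = inv_word w @ [inv_letter l]" "inv_word (inv_word w) = w"
  "length (inv_word w) = length w" "fst ` set (inv_word w) = fst ` set w"
  "inv_word w = [] \<longleftrightarrow> w = []"
  by (auto simp: inv_word_def rev_map image_image comp_def)

lemma reduced_words_iff:
  "w \<in> reduced_words X \<longleftrightarrow> fst ` set w \<subseteq> X \<and> successively (\<lambda>u v. v \<noteq> inv_letter u) w"
proof -
  have "(\<lambda>u v. \<not> (fst u = fst v \<and> snd u \<noteq> snd v)) = (\<lambda>u v :: 'a \<times> bool. v \<noteq> inv_letter u)"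
    by (auto simp: inv_letter_def prod_eq_iff fun_eq_iff)
  then show ?thesis by (simp only: reduced_words_def mem_Collect_eq)
qed

lemma reduced_words_append:
  "a @ b \<in> reduced_words X \<longleftrightarrow>
     a \<in> reduced_words X \<and> b \<in> reduced_words X \<and>
     (a \<noteq> [] \<and> b \<noteq> [] \<longrightarrow> hd b \<noteq> inv_letter (last a))"
  by (auto simp: reduced_words_iff successively_append_iff)

lemma reduced_words_Nil [simp]: "[] \<in> reduced_words X"
  by (simp add: reduced_words_iff)

lemma reduced_words_subset: "w \<in> reduced_words X \<Longrightarrow> fst ` set w \<subseteq> X"
  by (simp add: reduced_words_iff)

lemma reduced_words_inv_word:
  assumes "w \<in> reduced_words X"
  shows "inv_word w \<in> reduced_words X"
proof -
  have "successively (\<lambda>u v. v \<noteq> inv_letter u) (inv_word w) \<longleftrightarrow>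
        successively (\<lambda>u v. v \<noteq> inv_letter u) w"
    unfolding inv_word_def successively_rev successively_map
    by (rule arg_cong2[where f = successively]) (auto simp: fun_eq_iff inv_letter_eq_iff)
  with assms show ?thesis by (simp add: reduced_words_iff)
qed

context group
begin

definition letter_value :: "'a \<times> bool \<Rightarrow> 'a" where
  "letter_value l = (if snd l then fst l else inv (fst l))"

lemma letter_value_closed [simp]: "fst l \<in> carrier G \<Longrightarrow> letter_value l \<in> carrier G"
  by (simp add: letter_value_def)

lemma letter_value_inv_letter: "fst l \<in> carrier G \<Longrightarrow> letter_value (inv_letter l) = inv (letter_value l)"
  by (simp add: letter_value_def)

lemma word_value_Nil [simp]: "word_value G [] = \<one>"
  by (simp add: word_value_def)

lemma word_value_Cons: "word_value G (l # w) = letter_value l \<otimes> word_value G w"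
  by (simp add: word_value_def letter_value_def case_prod_unfold)

lemma word_value_closed [simp]: "fst ` set w \<subseteq> carrier G \<Longrightarrow> word_value G w \<in> carrier G"
  by (induction w) (auto simp: word_value_Cons)

lemma word_value_append:
  "fst ` set v \<subseteq> carrier G \<Longrightarrow> fst ` set w \<subseteq> carrier G \<Longrightarrow>
    word_value G (v @ w) = word_value G v \<otimes> word_value G w"
  by (induction v) (auto simp: word_value_Cons m_assoc)

lemma word_value_inv_word:
  "fst ` set w \<subseteq> carrier G \<Longrightarrow> word_value G (inv_word w) = inv (word_value G w)"
  by (induction w)
    (auto simp: word_value_Cons word_value_append letter_value_inv_letter inv_mult_group)

end

section \<open>Normal forms with respect to a fixed basis\<close>

locale based_free_group = group F for F (structure) +
  fixes X
  assumes basis: "free_basis F X"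
begin

lemma basis_subset: "X \<subseteq> carrier F"
  using basis by (simp add: free_basis_def)

lemma letters_in_carrier: "fst ` set w \<subseteq> X \<Longrightarrow> fst ` set w \<subseteq> carrier F"
  using basis_subset by blast

definition nf :: "'a \<Rightarrow> ('a \<times> bool) list" where
  "nf g = inv_into (reduced_words X) (word_value F) g"

lemma word_value_bij: "bij_betw (word_value F) (reduced_words X) (carrier F)"
  using basis by (simp add: free_basis_def)

lemma nf_reduced [simp]: "g \<in> carrier F \<Longrightarrow> nf g \<in> reduced_words X"
  unfolding nf_def by (rule inv_into_into) (use word_value_bij in \<open>simp add: bij_betw_def\<close>)

lemma word_value_nf [simp]: "g \<in> carrier F \<Longrightarrow> word_value F (nf g) = g"
  unfolding nf_def by (rule f_inv_into_f) (use word_value_bij in \<open>simp add: bij_betw_def\<close>)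

lemma nf_word_value [simp]: "w \<in> reduced_words X \<Longrightarrow> nf (word_value F w) = w"
  unfolding nf_def by (rule inv_into_f_f) (use word_value_bij in \<open>simp_all add: bij_betw_def\<close>)

lemma nf_letters: "g \<in> carrier F \<Longrightarrow> fst ` set (nf g) \<subseteq> X"
  using nf_reduced reduced_words_subset by blast

lemma val_closed [simp]: "fst ` set w \<subseteq> X \<Longrightarrow> word_value F w \<in> carrier F"
  by (simp add: letters_in_carrier)

lemma val_closed_reduced [simp]: "w \<in> reduced_words X \<Longrightarrow> word_value F w \<in> carrier F"
  by (simp add: reduced_words_subset)

lemma val_append:
  "fst ` set v \<subseteq> X \<Longrightarrow> fst ` set w \<subseteq> X \<Longrightarrow>
    word_value F (v @ w) = word_value F v \<otimes> word_value F w"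
  by (simp add: letters_in_carrier word_value_append)

lemma val_inv_word: "fst ` set w \<subseteq> X \<Longrightarrow> word_value F (inv_word w) = inv (word_value F w)"
  by (simp add: letters_in_carrier word_value_inv_word)

lemma letter_closed [simp]: "fst l \<in> X \<Longrightarrow> letter_value l \<in> carrier F"
  using basis_subset by auto

lemma nf_one [simp]: "nf \<one> = []"
  using nf_word_value[of "[]"] by simp

lemma nf_inv: "g \<in> carrier F \<Longrightarrow> nf (inv g) = inv_word (nf g)"
  using nf_word_value[OF reduced_words_inv_word[OF nf_reduced[of g]]]
  by (simp add: val_inv_word nf_letters)

text \<open>Cancellation happens only at the seam, so it is peeled off letter by letter from the end
  of \<open>a\<close>; \<open>c\<close> collects what disappears.\<close>

lemma reduced_append_cancel:
  assumes "a \<in> reduced_words X" "b \<in> reduced_words X"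
  shows "\<exists>a' c b'. a = a' @ c \<and> b = inv_word c @ b' \<and> a' @ b' \<in> reduced_words X"
  using assms
proof (induction a arbitrary: b rule: rev_induct)
  case Nil
  then show ?case by (intro exI[of _ "[]"] exI[of _ b]) simp
next
  case (snoc l a)
  show ?case
  proof (cases "b \<noteq> [] \<and> hd b = inv_letter l")
    case True
    then obtain b0 where b: "b = inv_letter l # b0" by (cases b) auto
    have "a \<in> reduced_words X" using snoc.prems(1) by (simp add: reduced_words_append)
    moreover have "b0 \<in> reduced_words X"
      using snoc.prems(2) reduced_words_append[of "[inv_letter l]" b0] by (simp add: b)
    ultimately obtain a' c b' where
      "a = a' @ c" "b0 = inv_word c @ b'" "a' @ b' \<in> reduced_words X"
      using snoc.IH by blast
    then have "a @ [l] = a' @ (c @ [l])" "b = inv_word (c @ [l]) @ b'" "a' @ b' \<in> reduced_words X"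
      by (simp_all add: b)
    then show ?thesis by blast
  next
    case False
    with snoc.prems have "(a @ [l]) @ b \<in> reduced_words X"
      by (subst reduced_words_append) auto
    then show ?thesis by (intro exI[of _ "a @ [l]"] exI[of _ "[]"] exI[of _ b]) simp
  qed
qed

text \<open>Later arguments control the cancellation in a product through the length and the end
  letters of \<open>c\<close>.\<close>

lemma nf_mult_cancel:
  assumes "g \<in> carrier F" "h \<in> carrier F"
  obtains a c b where "nf g = a @ c" "nf h = inv_word c @ b" "nf (g \<otimes> h) = a @ b"
    "a @ b \<in> reduced_words X"
proof -
  obtain a c b where abc: "nf g = a @ c" "nf h = inv_word c @ b" "a @ b \<in> reduced_words X"
    using reduced_append_cancel[OF nf_reduced nf_reduced, OF assms] by blast
  have s: "fst ` set a \<subseteq> X" "fst ` set b \<subseteq> X" "fst ` set c \<subseteq> X"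
    using nf_letters[OF assms(1)] nf_letters[OF assms(2)] abc by auto
  then have c: "word_value F a \<in> carrier F" "word_value F b \<in> carrier F" "word_value F c \<in> carrier F"
    by simp_all
  have "g = word_value F (a @ c)" "h = word_value F (inv_word c @ b)"
    using assms abc(1,2) by (metis word_value_nf)+
  then have "g = word_value F a \<otimes> word_value F c" "h = inv (word_value F c) \<otimes> word_value F b"
    using s by (simp_all add: val_append val_inv_word)
  then have "g \<otimes> h = word_value F (a @ b)"
    using s c by (simp add: val_append m_assoc inv_solve_left' flip: m_assoc[of "word_value F c"])
  with abc that show thesis by simp
qed

text \<open>The universal property. The images of reduced words need not be reduced, but the letters
  lost between \<open>nf g\<close> and \<open>nf h\<close> form a word followed by its inverse, and
  this cancels in \<open>M\<close> as well.\<close>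

theorem free_basis_hom_extension:
  fixes M :: "('c, 'd) monoid_scheme"
  assumes "group M" and f: "f \<in> X \<rightarrow> carrier M"
  obtains \<phi> where "\<phi> \<in> hom F M" "\<And>x. x \<in> X \<Longrightarrow> \<phi> x = f x"
proof -
  interpret M: group M by fact
  define fw :: "('a \<times> bool) list \<Rightarrow> ('c \<times> bool) list" where "fw = map (apfst f)"
  define \<phi> where "\<phi> g = word_value M (fw (nf g))" for g
  have fw_app: "fw (v @ w) = fw v @ fw w" for v w by (simp add: fw_def)
  have fw_inv: "fw (inv_word w) = inv_word (fw w)" for w
    by (auto simp: fw_def inv_word_def inv_letter_def rev_map)
  have fw_cl: "fst ` set (fw w) \<subseteq> carrier M" if "fst ` set w \<subseteq> X" for w
    using that f by (force simp: fw_def)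
  have "\<phi> \<in> hom F M"
  proof (rule homI)
    show "\<phi> g \<in> carrier M" if "g \<in> carrier F" for g
      using that by (simp add: \<phi>_def fw_cl nf_letters)
    fix g h assume gh: "g \<in> carrier F" "h \<in> carrier F"
    obtain a c b where abc: "nf g = a @ c" "nf h = inv_word c @ b" "nf (g \<otimes> h) = a @ b"
      using nf_mult_cancel[OF gh] by metis
    have "fst ` set a \<subseteq> X" "fst ` set b \<subseteq> X" "fst ` set c \<subseteq> X"
      using nf_letters[OF gh(1)] nf_letters[OF gh(2)] abc by auto
    note cl = this[THEN fw_cl]
    note cl' = cl[THEN M.word_value_closed]
    show "\<phi> (g \<otimes> h) = \<phi> g \<otimes>\<^bsub>M\<^esub> \<phi> h"
      using cl cl' unfolding \<phi>_def abc
      by (simp add: fw_app fw_inv M.word_value_append M.word_value_inv_word M.m_assoc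
          flip: M.m_assoc[of "word_value M (fw c)"])
  qed
  moreover have "\<phi> x = f x" if "x \<in> X" for x
  proof -
    have "[(x, True)] \<in> reduced_words X" using that by (simp add: reduced_words_iff)
    then have "nf x = [(x, True)]"
      using nf_word_value[of "[(x, True)]"] that basis_subset
      by (auto simp: word_value_Cons letter_value_def subset_eq)
    moreover have "f x \<in> carrier M" using that f by blast
    ultimately show ?thesis
      by (simp add: \<phi>_def fw_def M.word_value_Cons M.letter_value_def)
  qed
  ultimately show thesis by (rule that)
qed

end

section \<open>Unitriangular actions and finite nilpotent quotients\<close>

text \<open>Members of a pseudovariety have natural numbers as elements, so the finite factor group
  is transported along an injection of its cosets into the naturals.\<close>

lemma (in normal) nat_quotient:
  assumes "finite (rcosets H)"
  obtains N :: "nat monoid" and \<psi> where "group N" "finite (carrier N)" "\<psi> \<in> hom G N"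
    "\<psi> ` carrier G = carrier N" "\<And>g. g \<in> carrier G \<Longrightarrow> \<psi> g = \<one>\<^bsub>N\<^esub> \<longleftrightarrow> g \<in> H"
proof -
  interpret Q: group "G Mod H" by (rule factorgroup_is_group)
  obtain f :: "'a set \<Rightarrow> nat" where f: "inj_on f (carrier (G Mod H))"
    using finite_imp_inj_to_nat_seg[OF assms] by (auto simp: FactGroup_def)
  let ?N = "image_group f (G Mod H)" and ?\<psi> = "f \<circ> (\<lambda>g. H #> g)"
  have iso: "f \<in> iso (G Mod H) ?N" by (rule inj_imp_image_group_iso[OF f])
  show thesis
  proof (rule that)
    show "group ?N" by (rule Q.inj_imp_image_group_is_group[OF f])
    show "finite (carrier ?N)" using assms by (simp add: image_group_carrier FactGroup_def)
    show "?\<psi> \<in> hom G ?N"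
      using r_coset_hom_Mod iso_imp_homomorphism[OF iso] by (auto simp: hom_def Pi_iff)
    show "?\<psi> ` carrier G = carrier ?N"
      by (auto simp: image_group_carrier FactGroup_def RCOSETS_def)
    show "?\<psi> g = \<one>\<^bsub>?N\<^esub> \<longleftrightarrow> g \<in> H" if g: "g \<in> carrier G" for g
    proof -
      have "H #> g \<in> carrier (G Mod H)" "H \<in> carrier (G Mod H)"
        using g rcosetsI[OF subset, of g] subgroup_in_rcosets[OF group_axioms]
        by (auto simp: FactGroup_def)
      then have "f (H #> g) = f H \<longleftrightarrow> H #> g = H" using f by (auto simp: inj_on_def)
      also have "\<dots> \<longleftrightarrow> g \<in> H"
        using coset_join1[OF _ g subgroup_axioms] coset_join2[OF g subgroup_axioms] by blast
      finally show ?thesis by (simp add: image_group_one)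
    qed
  qed
qed

text \<open>By induction the images of the \<open>D i\<close> dominate the lower central series of
  \<open>N\<close>. The subgroups \<open>level i\<close> below will play the role of
  \<open>D\<close>.\<close>

lemma (in group) nilpotent_image:
  assumes N: "group N" and \<psi>: "\<psi> \<in> hom G N" and onto: "\<psi> ` carrier G = carrier N"
    and D: "\<And>i. subgroup (D i) G" "D 0 = carrier G"
    and comm: "\<And>i x y. x \<in> D i \<Longrightarrow> y \<in> carrier G \<Longrightarrow> x \<otimes> y \<otimes> inv x \<otimes> inv y \<in> D (Suc i)"
    and last: "\<psi> ` D n \<subseteq> {\<one>\<^bsub>N\<^esub>}"
  shows "nilpotent_group N"
proof -
  interpret N: group N by fact
  interpret h: group_hom G N \<psi> by unfold_locales (rule \<psi>)
  have sub: "lower_central N i \<subseteq> \<psi> ` D i" for i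
  proof (induction i)
    case 0
    then show ?case by (simp add: D onto)
  next
    case (Suc i)
    have S: "subgroup (\<psi> ` D (Suc i)) N" by (rule h.subgroup_img_is_subgroup[OF D(1)])
    have "x \<otimes>\<^bsub>N\<^esub> y \<otimes>\<^bsub>N\<^esub> inv\<^bsub>N\<^esub> x \<otimes>\<^bsub>N\<^esub> inv\<^bsub>N\<^esub> y \<in> \<psi> ` D (Suc i)"
      if xy: "x \<in> lower_central N i" "y \<in> carrier N" for x y
    proof -
      obtain x' y' where *: "x = \<psi> x'" "x' \<in> D i" "y = \<psi> y'" "y' \<in> carrier G"
        using xy Suc onto by blast
      then have "x' \<in> carrier G" using subgroup.subset[OF D(1)] by blast
      then have "x \<otimes>\<^bsub>N\<^esub> y \<otimes>\<^bsub>N\<^esub> inv\<^bsub>N\<^esub> x \<otimes>\<^bsub>N\<^esub> inv\<^bsub>N\<^esub> y = \<psi> (x' \<otimes> y' \<otimes> inv x' \<otimes> inv y')"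
        using * by simp
      then show ?thesis using comm[OF *(2,4)] by blast
    qed
    then show ?case by (auto intro!: N.generate_subgroup_incl[OF _ S])
  qed
  have "\<one>\<^bsub>N\<^esub> \<in> lower_central N n"
    by (cases n) (auto intro: generate.one)
  with sub[of n] last have "lower_central N n = {\<one>\<^bsub>N\<^esub>}" by blast
  with N show ?thesis by (auto simp: nilpotent_group_def)
qed

section \<open>Filtered integer vectors and unipotent actions\<close>

text \<open>
  On the coordinates \<open>0, \<dots>, n\<close> the step \<open>m = 0\<close> consists of the multiples of \<open>q\<close> and the steps
  \<open>m > n\<close> of all vectors. The truncated subtractions \<open>m - i\<close> below are intended.
\<close>
definition coord_filtration :: "nat \<Rightarrow> nat \<Rightarrow> nat \<Rightarrow> (nat \<Rightarrow> int) set" where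
  "coord_filtration q n m = {v. \<forall>j. m \<le> j \<and> j \<le> n \<longrightarrow> int q dvd v j}"

lemma coord_filtration_mono:
  "v \<in> coord_filtration q n m \<Longrightarrow> m \<le> m' \<Longrightarrow> v \<in> coord_filtration q n m'"
  by (auto simp: coord_filtration_def)

lemma coord_filtration_add:
  "u \<in> coord_filtration q n m \<Longrightarrow> v \<in> coord_filtration q n m \<Longrightarrow> u + v \<in> coord_filtration q n m"
  by (auto simp: coord_filtration_def)

lemma coord_filtration_diff:
  "u \<in> coord_filtration q n m \<Longrightarrow> v \<in> coord_filtration q n m \<Longrightarrow> u - v \<in> coord_filtration q n m"
  by (auto simp: coord_filtration_def)

text \<open>The vectors stay integral, so no arithmetic of residues is needed: congruence modulo
  \<open>q\<close> in the coordinates 0, ..., n is membership of the difference in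
  \<open>coord_filtration q n 0\<close>. The axiom \<open>act_level\<close> expresses
  unitriangularity modulo \<open>q\<close>.\<close>

locale unipotent_action = group G for G (structure) +
  fixes \<rho> :: "'a \<Rightarrow> (nat \<Rightarrow> int) \<Rightarrow> nat \<Rightarrow> int" and q n :: nat
  assumes q_pos: "q > 0"
    and act_one: "\<rho> \<one> v = v"
    and act_mult: "g \<in> carrier G \<Longrightarrow> h \<in> carrier G \<Longrightarrow> \<rho> (g \<otimes> h) v = \<rho> g (\<rho> h v)"
    and act_add: "g \<in> carrier G \<Longrightarrow> \<rho> g (u + v) = \<rho> g u + \<rho> g v"
    and act_level: "g \<in> carrier G \<Longrightarrow> v \<in> coord_filtration q n m \<Longrightarrow>
      \<rho> g v - v \<in> coord_filtration q n (m - 1)"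
begin

abbreviation "Vf \<equiv> coord_filtration q n"

lemma Vf_last: "v \<in> Vf (Suc n)"
  by (auto simp: coord_filtration_def)

lemma act_diff: "g \<in> carrier G \<Longrightarrow> \<rho> g (u - v) = \<rho> g u - \<rho> g v"
  using act_add[of g "u - v" v] by (simp add: algebra_simps)

lemma act_inv: "g \<in> carrier G \<Longrightarrow> \<rho> g (\<rho> (inv g) v) = v"
  using act_mult[of g "inv g" v] by (simp add: act_one)

lemma act_Vf:
  assumes "g \<in> carrier G" "v \<in> Vf m"
  shows "\<rho> g v \<in> Vf m"
proof -
  have "(\<rho> g v - v) + v \<in> Vf m"
    by (rule coord_filtration_add[OF coord_filtration_mono[OF act_level[OF assms]] assms(2)]) simp
  then show ?thesis by simp
qed

text \<open>The analogue of the subgroups 1 + N^(i+1) of a unitriangular group; the shift by one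
  makes \<open>level 0\<close> the whole group. As \<open>Vf (Suc n)\<close> contains all vectors,
  \<open>level n\<close> is the kernel of the action modulo \<open>q\<close>.\<close>

definition level :: "nat \<Rightarrow> 'a set" where
  "level i = {g \<in> carrier G. \<forall>m. \<forall>v \<in> Vf m. \<rho> g v - v \<in> Vf (m - Suc i)}"

lemma level_carrier: "g \<in> level i \<Longrightarrow> g \<in> carrier G"
  by (simp add: level_def)

lemma levelD: "g \<in> level i \<Longrightarrow> v \<in> Vf m \<Longrightarrow> \<rho> g v - v \<in> Vf (m - Suc i)"
  by (simp add: level_def)

lemma level_0: "level 0 = carrier G"
  using act_level by (auto simp: level_def)

lemma subgroup_level: "subgroup (level i) G"
proof (rule subgroupI)
  show "level i \<subseteq> carrier G" by (auto simp: level_def)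
  have "\<one> \<in> level i" by (auto simp: level_def act_one coord_filtration_def)
  then show "level i \<noteq> {}" by blast
next
  fix g assume g: "g \<in> level i"
  note gc = level_carrier[OF g]
  have "\<rho> (inv g) v - v \<in> Vf (m - Suc i)" if v: "v \<in> Vf m" for m v
  proof -
    let ?u = "\<rho> (inv g) v"
    have u: "?u \<in> Vf m" using gc v by (simp add: act_Vf)
    have "0 - (\<rho> g ?u - ?u) \<in> Vf (m - Suc i)"
      by (rule coord_filtration_diff[OF _ levelD[OF g u]]) (simp add: coord_filtration_def)
    then show ?thesis by (simp add: act_inv gc)
  qed
  then show "inv g \<in> level i" using gc by (simp add: level_def)
next
  fix g h assume g: "g \<in> level i" and h: "h \<in> level i"
  note gc = level_carrier[OF g] and hc = level_carrier[OF h]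
  have "\<rho> (g \<otimes> h) v - v \<in> Vf (m - Suc i)" if v: "v \<in> Vf m" for m v
  proof -
    have "(\<rho> g (\<rho> h v) - \<rho> h v) + (\<rho> h v - v) \<in> Vf (m - Suc i)"
      by (rule coord_filtration_add[OF levelD[OF g act_Vf[OF hc v]] levelD[OF h v]])
    then show ?thesis by (simp add: act_mult gc hc)
  qed
  then show "g \<otimes> h \<in> level i" using gc hc by (simp add: level_def)
qed

text \<open>With u = x^-1 y^-1 v the difference is x y u - y x u = (x - 1)(y - 1) u - (y - 1)(x - 1)
  u. In both terms x - 1 descends i + 1 steps and y - 1 one more.\<close>

lemma level_commutator:
  assumes x: "x \<in> level i" and y: "y \<in> carrier G"
  shows "x \<otimes> y \<otimes> inv x \<otimes> inv y \<in> level (Suc i)"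
proof -
  note xc = level_carrier[OF x]
  let ?c = "x \<otimes> y \<otimes> inv x \<otimes> inv y"
  have "\<rho> ?c v - v \<in> Vf (m - Suc (Suc i))" if v: "v \<in> Vf m" for m v
  proof -
    define u where "u = \<rho> (inv x \<otimes> inv y) v"
    have u: "u \<in> Vf m" unfolding u_def using xc y v by (simp add: act_Vf)
    define a b where "a = \<rho> x u - u" and "b = \<rho> y u - u"
    have a: "a \<in> Vf (m - Suc i)" unfolding a_def by (rule levelD[OF x u])
    have b: "b \<in> Vf (m - 1)" unfolding b_def by (rule act_level[OF y u])
    have "?c = (x \<otimes> y) \<otimes> (inv x \<otimes> inv y)" using xc y by (simp add: m_assoc)
    then have "\<rho> ?c v = \<rho> x (\<rho> y u)"
      unfolding u_def using xc y by (simp only: act_mult m_closed inv_closed)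
    also have "\<rho> y u = u + b" by (simp add: b_def)
    finally have "\<rho> ?c v = \<rho> x u + \<rho> x b" by (simp only: act_add[OF xc])
    then have c: "\<rho> ?c v = (u + a) + \<rho> x b" by (simp add: a_def)
    have "v = \<rho> y (\<rho> x u)" using xc y by (simp add: u_def act_mult act_inv)
    also have "\<rho> x u = u + a" by (simp add: a_def)
    finally have "v = \<rho> y u + \<rho> y a" by (simp only: act_add[OF y])
    then have "v = (u + b) + \<rho> y a" by (simp add: b_def)
    with c have "\<rho> ?c v - v = (\<rho> x b - b) - (\<rho> y a - a)"
      by (simp add: algebra_simps)
    moreover have "(\<rho> x b - b) - (\<rho> y a - a) \<in> Vf (m - Suc (Suc i))"
      using coord_filtration_diff levelD[OF x b] act_level[OF y a] by simp
    ultimately show ?thesis by simp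
  qed
  then show ?thesis using xc y by (simp add: level_def)
qed

lemma level_Suc_subset: "level (Suc i) \<subseteq> level i"
  using coord_filtration_mono by (auto simp: level_def) (meson coord_filtration_mono diff_le_mono2 le_SucI order_refl)

text \<open>Normality comes from x h x^-1 = [h, x]^-1 h, since the commutator lies even in the next
  level.\<close>

lemma normal_level: "level i \<lhd> G"
proof (unfold normal_inv_iff, intro conjI ballI)
  show "subgroup (level i) G" by (rule subgroup_level)
  then interpret L: subgroup "level i" G .
  fix x h assume x: "x \<in> carrier G" and h: "h \<in> level i"
  have hc: "h \<in> carrier G" by (rule level_carrier[OF h])
  have "h \<otimes> x \<otimes> inv h \<otimes> inv x \<in> level i"
    using level_commutator[OF h x] level_Suc_subset by blast
  then have "inv (h \<otimes> x \<otimes> inv h \<otimes> inv x) \<otimes> h \<in> level i" using h by simp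
  also have "inv (h \<otimes> x \<otimes> inv h \<otimes> inv x) \<otimes> h = x \<otimes> h \<otimes> inv x"
    using x hc by (simp add: inv_mult_group m_assoc)
  finally show "x \<otimes> h \<otimes> inv x \<in> level i" .
qed

text \<open>Binomial expansion to first order: y^t - 1 and t (y - 1) agree up to terms with a
  further factor y - 1, which descend at least one more step. For t = q the linear term is divisible
  by \<open>q\<close> and lies in every step.\<close>

lemma level_power:
  assumes y: "y \<in> level i"
  shows "y [^] q \<in> level (Suc i)"
proof -
  note yc = level_carrier[OF y]
  have *: "\<rho> (y [^] t) v - v - (\<lambda>j. int t * (\<rho> y v - v) j) \<in> Vf (m - Suc (Suc i))"
    if v: "v \<in> Vf m" for v m and t :: nat
  proof (induction t)
    case 0
    then show ?case by (auto simp: act_one coord_filtration_def)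
  next
    case (Suc t)
    define z where "z = \<rho> (y [^] t) v - v"
    have "z \<in> Vf (m - Suc i)"
    proof -
      have "y [^] t \<in> level i"
        by (induction t) (use subgroup_level[of i] y in \<open>auto simp: subgroup_def\<close>)
      then show ?thesis unfolding z_def using levelD v by blast
    qed
    then have "\<rho> y z - z \<in> Vf (m - Suc (Suc i))"
      using act_level[OF yc] by fastforce
    then have "(\<rho> y z - z) + (z - (\<lambda>j. int t * (\<rho> y v - v) j)) \<in> Vf (m - Suc (Suc i))"
      by (rule coord_filtration_add) (use Suc in \<open>simp only: z_def\<close>)
    moreover have "\<rho> (y [^] Suc t) v = \<rho> y (\<rho> (y [^] t) v)"
      unfolding nat_pow_Suc2[OF yc] by (rule act_mult) (use yc in auto)
    then have "\<rho> (y [^] Suc t) v = \<rho> y v + \<rho> y z"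
      using yc by (simp add: z_def act_diff)
    then have "\<rho> (y [^] Suc t) v - v - (\<lambda>j. int (Suc t) * (\<rho> y v - v) j) =
        (\<rho> y z - z) + (z - (\<lambda>j. int t * (\<rho> y v - v) j))"
      by (simp add: fun_eq_iff algebra_simps del: nat_pow_Suc)
    ultimately show ?case by (simp only:)
  qed
  have "\<rho> (y [^] q) v - v \<in> Vf (m - Suc (Suc i))" if v: "v \<in> Vf m" for v m
  proof -
    have "(\<lambda>j. int q * (\<rho> y v - v) j) \<in> Vf (m - Suc (Suc i))"
      by (simp add: coord_filtration_def)
    from coord_filtration_add[OF *[OF v, of q] this] show ?thesis by simp
  qed
  then show ?thesis using yc by (simp add: level_def)
qed

lemma power_level: "x \<in> carrier G \<Longrightarrow> x [^] (q ^ i) \<in> level i"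
proof (induction i)
  case (Suc i)
  from level_power[OF Suc.IH[OF Suc.prems]] Suc.prems show ?case
    by (simp add: nat_pow_pow mult.commute)
qed (simp add: level_0)

text \<open>The coset of g is determined by the values of g, modulo \<open>q\<close>, on the
  finitely many vectors that are supported on 0, ..., n and have entries below \<open>q\<close>. The
  table \<open>c g\<close> records them.\<close>

lemma finite_rcosets_level: "finite (rcosets (level n))"
proof -
  define W where "W = {v :: nat \<Rightarrow> int. \<forall>j. (j \<in> {..n} \<longrightarrow> v j \<in> {0..<int q}) \<and> (j \<notin> {..n} \<longrightarrow> v j = 0)}"
  have "finite W" unfolding W_def by (rule finite_set_of_finite_funs) auto
  define c where "c g = restrict (\<lambda>v. restrict (\<lambda>j. \<rho> g v j mod int q) {..n}) W" for g
  have "c ` carrier G \<subseteq> (\<Pi>\<^sub>E v\<in>W. \<Pi>\<^sub>E j\<in>{..n}. {0..<int q})"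
    using q_pos by (auto simp: c_def split: if_splits)
  moreover have "finite (\<Pi>\<^sub>E v\<in>W. \<Pi>\<^sub>E j\<in>{..n}. {0..<int q})"
    by (intro finite_PiE \<open>finite W\<close>) auto
  ultimately have fin: "finite (c ` carrier G)" by (rule finite_subset)
  have key: "g \<otimes> inv h \<in> level n" if g: "g \<in> carrier G" and h: "h \<in> carrier G" and eq: "c g = c h" for g h
  proof -
    have "\<rho> (g \<otimes> inv h) v - v \<in> Vf 0" for v
    proof -
      define u where "u = \<rho> (inv h) v"
      \<comment> \<open>\<open>w\<close> is \<open>u\<close> reduced modulo \<open>q\<close>. The
        tables only see \<open>w\<close>; the error u - w lies in \<open>Vf 0\<close>, which every
        group element preserves.\<close>
      define w where "w = (\<lambda>j. if j \<le> n then u j mod int q else 0)"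
      have w: "w \<in> W" using q_pos by (auto simp: W_def w_def)
      have d: "u - w \<in> Vf 0" by (auto simp: coord_filtration_def w_def)
      have "\<rho> g w - \<rho> h w \<in> Vf 0"
      proof -
        have "\<rho> g w j mod int q = \<rho> h w j mod int q" if "j \<le> n" for j
        proof -
          have "c g w j = c h w j" by (simp add: eq)
          then show ?thesis using w that by (simp add: c_def)
        qed
        then show ?thesis by (auto simp: coord_filtration_def mod_eq_dvd_iff)
      qed
      moreover have "\<rho> g (u - w) - \<rho> h (u - w) \<in> Vf 0"
        by (rule coord_filtration_diff[OF act_Vf[OF g d] act_Vf[OF h d]])
      ultimately have "(\<rho> g (u - w) - \<rho> h (u - w)) + (\<rho> g w - \<rho> h w) \<in> Vf 0"
        by (intro coord_filtration_add)
      also have "(\<rho> g (u - w) - \<rho> h (u - w)) + (\<rho> g w - \<rho> h w) = \<rho> (g \<otimes> inv h) v - v"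
        using g h by (simp add: act_diff act_mult u_def act_inv)
      finally show ?thesis .
    qed
    moreover have "Vf 0 \<subseteq> Vf m" for m using coord_filtration_mono by blast
    ultimately show ?thesis using g h by (auto simp: level_def)
  qed
  interpret L: normal "level n" G by (rule normal_level)
  have "rcosets (level n) \<subseteq> (\<lambda>y. level n #> inv_into (carrier G) c y) ` c ` carrier G"
  proof
    fix R assume "R \<in> rcosets (level n)"
    then obtain g where g: "g \<in> carrier G" "R = level n #> g" by (auto simp: RCOSETS_def)
    define h where "h = inv_into (carrier G) c (c g)"
    have h: "h \<in> carrier G" "c h = c g"
      unfolding h_def using g(1) by (auto intro: inv_into_into f_inv_into_f)
    have "level n #> g = level n #> h"
      using key[OF h(1) g(1) h(2)] g(1) h(1) L.rcos_module[OF group_axioms, of g h]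
        repr_independence[OF _ g(1) L.subgroup_axioms] by blast
    then show "R \<in> (\<lambda>y. level n #> inv_into (carrier G) c y) ` c ` carrier G"
      using g h_def by auto
  qed
  then show ?thesis using fin finite_surj by blast
qed

text \<open>The quotient by \<open>level n\<close>. The bound on the exponent, coming from
  \<open>power_level\<close>, is what makes all orders in the image powers of p once
  \<open>q\<close> is one.\<close>

theorem finite_nilpotent_quotient:
  obtains N :: "nat monoid" and \<psi> where "nilpotent_group N" "finite (carrier N)" "\<psi> \<in> hom G N"
    "\<And>x. x \<in> carrier G \<Longrightarrow> \<psi> x [^]\<^bsub>N\<^esub> (q ^ n) = \<one>\<^bsub>N\<^esub>"
    "\<And>g v. g \<in> carrier G \<Longrightarrow> \<psi> g = \<one>\<^bsub>N\<^esub> \<Longrightarrow> \<rho> g v - v \<in> Vf 0"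
proof -
  interpret L: normal "level n" G by (rule normal_level)
  obtain N :: "nat monoid" and \<psi> where N: "group N" "finite (carrier N)" "\<psi> \<in> hom G N"
    "\<psi> ` carrier G = carrier N" and ker: "\<And>g. g \<in> carrier G \<Longrightarrow> \<psi> g = \<one>\<^bsub>N\<^esub> \<longleftrightarrow> g \<in> level n"
    using L.nat_quotient[OF finite_rcosets_level] by blast
  interpret h: group_hom G N \<psi>
    using N by (simp add: group_hom_def group_hom_axioms_def group_axioms)
  show thesis
  proof (rule that[OF _ N(2,3)])
    show "nilpotent_group N"
      using N(1,3,4) subgroup_level level_0 level_commutator
      by (rule nilpotent_image[where D = level and n = n]) (use ker level_carrier in auto)
    show "\<psi> x [^]\<^bsub>N\<^esub> (q ^ n) = \<one>\<^bsub>N\<^esub>" if "x \<in> carrier G" for x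
      using that ker[of "x [^] (q ^ n)"] power_level by (simp add: h.hom_nat_pow)
    show "\<rho> g v - v \<in> Vf 0" if "g \<in> carrier G" "\<psi> g = \<one>\<^bsub>N\<^esub>" for g v
      using that ker levelD[of g n v "Suc n"] Vf_last by simp
  qed
qed

end

section \<open>Free groups are residually p\<close>

definition transvection :: "nat set \<Rightarrow> int \<Rightarrow> (nat \<Rightarrow> int) \<Rightarrow> nat \<Rightarrow> int" where
  "transvection P e v = (\<lambda>r. v r + (if r \<in> P then e * v (Suc r) else 0))"

lemma transvection_0: "transvection P 0 v = v"
  by (auto simp: transvection_def)

text \<open>Without consecutive positions in \<open>P\<close>, the shift N along \<open>P\<close>
  has square zero, so (1 + a N)(1 + b N) = 1 + (a + b) N. Powers of a generator therefore act by a
  transvection with the exponent as coefficient.\<close>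

lemma transvection_add:
  "(\<And>r. r \<in> P \<Longrightarrow> Suc r \<notin> P) \<Longrightarrow> transvection P a (transvection P b v) = transvection P (a + b) v"
  by (auto simp: transvection_def fun_eq_iff algebra_simps)

lemma transvection_linear: "transvection P e (u + v) = transvection P e u + transvection P e v"
  by (auto simp: transvection_def fun_eq_iff algebra_simps)

text \<open>Positions stop at n - 1 because a transvection reads the coordinate
  \<open>Suc r\<close>, which must still be one that the filtration controls.\<close>

lemma transvection_level:
  assumes "P \<subseteq> {..<n}" "v \<in> coord_filtration q n m"
  shows "transvection P e v - v \<in> coord_filtration q n (m - 1)"
  using assms by (auto simp: transvection_def coord_filtration_def)

section \<open>Syllable decompositions\<close>

definition (in group) syllable_value :: "('a \<times> int) list \<Rightarrow> 'a" where
  "syllable_value s = foldr (\<lambda>(x, e) h. x [^] e \<otimes> h) s \<one>"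

context group
begin

lemma syllable_value_Nil [simp]: "syllable_value [] = \<one>"
  by (simp add: syllable_value_def)

lemma syllable_value_Cons [simp]:
  "syllable_value ((x, e) # s) = x [^] e \<otimes> syllable_value s"
  by (simp add: syllable_value_def)

lemma syllable_value_closed [simp]:
  "fst ` set s \<subseteq> carrier G \<Longrightarrow> syllable_value s \<in> carrier G"
  by (induction s) auto

lemma syllable_value_append:
  "fst ` set s \<subseteq> carrier G \<Longrightarrow> fst ` set t \<subseteq> carrier G \<Longrightarrow>
    syllable_value (s @ t) = syllable_value s \<otimes> syllable_value t"
  by (induction s) (auto simp: m_assoc)

lemma word_value_syllables:
  "fst ` set w \<subseteq> carrier G \<Longrightarrow>
    syllable_value (map (\<lambda>l. (fst l, if snd l then 1 else - 1)) w) = word_value G w"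
  by (induction w) (auto simp: word_value_Cons letter_value_def int_pow_neg)

text \<open>In an expression with the fewest syllables no exponent is zero and no two neighbours
  share a base: dropping the one or merging the two would shorten it. This replaces an explicit
  grouping of the letters of a word.\<close>

lemma minimal_syllables:
  assumes "g \<in> word_value G ` {w. fst ` set w \<subseteq> X}" "X \<subseteq> carrier G"
  obtains s where "fst ` set s \<subseteq> X" "syllable_value s = g" "0 \<notin> snd ` set s"
    "successively (\<lambda>u v. fst u \<noteq> fst v) s"
proof -
  define P where "P s \<longleftrightarrow> fst ` set s \<subseteq> X \<and> syllable_value s = g" for s
  obtain w where w: "fst ` set w \<subseteq> X" "g = word_value G w" using assms by blast
  have "P (map (\<lambda>l. (fst l, if snd l then 1 else - 1)) w)"
    unfolding P_def using w assms(2)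
    by (intro conjI, force) (subst word_value_syllables, auto)
  then obtain s where s: "P s" and min: "\<And>t. P t \<Longrightarrow> length s \<le> length t"
    using ex_has_least_nat[of P _ length] by blast
  show thesis
  proof (rule that)
    show "fst ` set s \<subseteq> X" "syllable_value s = g" using s by (simp_all add: P_def)
    show "0 \<notin> snd ` set s"
    proof
      assume "0 \<in> snd ` set s"
      then obtain x where "(x, 0) \<in> set s" by force
      then obtain a b where ab: "s = a @ (x, 0) # b" by (auto simp: in_set_conv_decomp)
      have "fst ` set a \<subseteq> carrier G" "fst ` set b \<subseteq> carrier G" "x \<in> carrier G"
        using s assms(2) by (auto simp: P_def ab)
      then have "syllable_value (a @ b) = syllable_value s"
        unfolding ab by (subst (1 2) syllable_value_append) auto
      then have "P (a @ b)" using s by (auto simp: P_def ab)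
      from min[OF this] show False by (simp add: ab)
    qed
    show "successively (\<lambda>u v. fst u \<noteq> fst v) s"
    proof (unfold successively_conv_nth, intro allI impI notI)
      fix i assume i: "Suc i < length s" and eq: "fst (s ! i) = fst (s ! Suc i)"
      define a b where "a = take i s" and "b = drop (Suc (Suc i)) s"
      obtain x e f where xef: "s ! i = (x, e)" "s ! Suc i = (x, f)"
        using eq by (metis prod.collapse)
      have ab: "s = a @ (x, e) # (x, f) # b"
        using i xef by (simp add: a_def b_def Cons_nth_drop_Suc flip: xef id_take_nth_drop)
      have c: "fst ` set a \<subseteq> carrier G" "fst ` set b \<subseteq> carrier G" "x \<in> carrier G"
        using s assms(2) by (auto simp: P_def ab)
      then have "syllable_value (a @ (x, e + f) # b) = syllable_value s"
        unfolding ab by (subst (1 2) syllable_value_append) (auto simp: int_pow_mult m_assoc)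
      then have "P (a @ (x, e + f) # b)" using s by (auto simp: P_def ab)
      from min[OF this] show False by (simp add: ab)
    qed
  qed
qed

end

context based_free_group
begin

theorem residually_p:
  fixes p :: nat
  assumes g: "g \<in> carrier F" "g \<noteq> \<one>" and p: "prime p"
  obtains N :: "nat monoid" and \<psi> and k :: nat where "nilpotent_group N" "finite (carrier N)"
    "\<psi> \<in> hom F N" "\<psi> g \<noteq> \<one>\<^bsub>N\<^esub>" "\<And>x. x \<in> carrier F \<Longrightarrow> \<psi> x [^]\<^bsub>N\<^esub> (p ^ k) = \<one>\<^bsub>N\<^esub>"
proof -
  have "g \<in> word_value F ` {w. fst ` set w \<subseteq> X}"
    using word_value_nf[OF g(1)] nf_letters[OF g(1)] by (metis (mono_tags) image_eqI mem_Collect_eq)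
  then obtain s where s: "fst ` set s \<subseteq> X" "syllable_value s = g" "0 \<notin> snd ` set s"
    "successively (\<lambda>u v. fst u \<noteq> fst v) s"
    using minimal_syllables basis_subset by blast
  define n where "n = length s"
  define P where "P x = {r. r < n \<and> fst (s ! r) = x}" for x
  have P: "P x \<subseteq> {..<n}" "r \<in> P x \<Longrightarrow> Suc r \<notin> P x" for x r
    using successively_nth[OF s(4), of r] by (auto simp: P_def n_def)
  \<comment> \<open>Plain bijections suffice as target of the universal property; additivity and the
    filtration condition are recovered afterwards along words.\<close>
  let ?M = "BijGroup (UNIV :: (nat \<Rightarrow> int) set)"
  have comp_id: "transvection (P x) (- e) \<circ> transvection (P x) e = id" for x e
    by (auto simp: fun_eq_iff transvection_add[OF P(2)] transvection_0)
  have tv: "transvection (P x) 1 \<in> carrier ?M" for x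
  proof -
    have "bij (transvection (P x) 1)"
      by (rule o_bij[OF comp_id]) (use comp_id[of x "- 1"] in simp)
    then show ?thesis by (simp add: BijGroup_def Bij_def)
  qed
  obtain \<phi> where \<phi>: "\<phi> \<in> hom F ?M" "\<And>x. x \<in> X \<Longrightarrow> \<phi> x = transvection (P x) 1"
    using free_basis_hom_extension[OF group_BijGroup, of "\<lambda>x. transvection (P x) 1"] tv by blast
  interpret h: group_hom F ?M \<phi>
    using \<phi>(1) by (simp add: group_hom_def group_hom_axioms_def group_BijGroup group_axioms)
  have mult: "\<phi> (a \<otimes> b) v = \<phi> a (\<phi> b v)" if "a \<in> carrier F" "b \<in> carrier F" for a b v
    using h.hom_mult[OF that] h.hom_closed[OF that(1)] h.hom_closed[OF that(2)]
    by (simp add: BijGroup_def compose_def)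
  have one: "\<phi> \<one> v = v" for v
    unfolding h.hom_one unfolding BijGroup_def by simp
  note [simp del] = h.hom_one h.hom_mult
  have nat_pow: "\<phi> (x [^] k) v = transvection (P x) (int k) v" if "x \<in> X" for x v and k :: nat
  proof (induction k arbitrary: v)
    case 0
    then show ?case by (simp add: one transvection_0)
  next
    case (Suc k)
    have "x \<in> carrier F" using that basis_subset by blast
    then show ?case
      by (simp add: mult Suc \<phi>(2)[OF that] transvection_add[OF P(2)] add.commute)
  qed
  have int_pow: "\<phi> (x [^] e) v = transvection (P x) e v" if "x \<in> X" for x v and e :: int
  proof (cases e rule: int_cases2)
    case (nonneg k)
    then show ?thesis using nat_pow[OF that] by (simp add: int_pow_int)
  next
    case (nonpos k)
    have x: "x \<in> carrier F" using that basis_subset by blast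
    have "v = \<phi> (x [^] k) (transvection (P x) e v)"
      by (simp add: nat_pow[OF that] nonpos transvection_add[OF P(2)] transvection_0)
    then have "\<phi> (x [^] e) v = \<phi> (x [^] e) (\<phi> (x [^] k) (transvection (P x) e v))" by simp
    also have "\<dots> = \<phi> (x [^] e \<otimes> x [^] k) (transvection (P x) e v)"
      using x by (simp add: mult)
    also have "x [^] e \<otimes> x [^] k = \<one>"
      using x by (simp add: nonpos int_pow_neg int_pow_int)
    finally show ?thesis by (simp add: one)
  qed
  \<comment> \<open>\<open>d\<close> is the last coordinate vector. Applying the syllables from
    right to left, each one moves the lowest possibly nonzero coordinate down by one position and
    multiplies its entry by the exponent, so coordinate 0 of g d is the product of all
    exponents.\<close>
  define d :: "nat \<Rightarrow> int" where "d j = (if j = n then 1 else 0)" for j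
  have coeff: "\<phi> (syllable_value t) d (length r) = prod_list (map snd t) \<and>
      (\<forall>j < length r. \<phi> (syllable_value t) d j = 0)" if "s = r @ t" for r t
    using that
  proof (induction t arbitrary: r)
    case Nil
    then show ?case by (simp add: one d_def n_def)
  next
    case (Cons l t)
    obtain x e where l: "l = (x, e)" by (cases l)
    have x: "x \<in> X" and t: "fst ` set t \<subseteq> X" using s(1) Cons.prems by (auto simp: l)
    have "length r \<in> P x" by (simp add: P_def n_def Cons.prems l)
    moreover have "\<phi> (syllable_value (l # t)) d =
        transvection (P x) e (\<phi> (syllable_value t) d)"
      unfolding l syllable_value_Cons int_pow[OF x, symmetric]
      by (rule mult) (use x t basis_subset in auto)
    moreover have "s = (r @ [l]) @ t" using Cons.prems by simp
    note Cons.IH[OF this]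
    ultimately show ?case by (auto simp: transvection_def l)
  qed
  define E where "E = prod_list (map snd s)"
  have E: "E \<noteq> 0" using s(3) by (auto simp: E_def prod_list_zero_iff)
  have n: "n > 0" using s(2) g(2) by (auto simp: n_def)
  have p1: "p > 1" using p prime_gt_1_nat by blast
  \<comment> \<open>This power of p exceeds the absolute value of the nonzero integer
    \<open>E\<close> and hence does not divide it.\<close>
  define q where "q = p ^ nat \<bar>E\<bar>"
  have "nat \<bar>E\<bar> < q" unfolding q_def using p1 power_gt_expt[of p] by simp
  have "unipotent_action F \<phi> q n"
  proof unfold_locales
    show "q > 0" using p1 by (simp add: q_def)
    show "\<phi> \<one> v = v" for v by (rule one)
    show "\<phi> (g \<otimes> h) v = \<phi> g (\<phi> h v)" if "g \<in> carrier F" "h \<in> carrier F" for g h v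
      by (rule mult[OF that])
    have letter: "\<exists>x. \<exists>e::int. x \<in> X \<and> letter_value l = x [^] e" if "fst l \<in> X" for l
      using that basis_subset
      by (intro exI[of _ "fst l"] exI[of _ "if snd l then 1 else - 1 :: int"])
        (auto simp: letter_value_def int_pow_neg)
    \<comment> \<open>An element of \<open>BijGroup\<close> carries no linear structure, so
      additivity is checked letter by letter and reaches \<open>g\<close> through its normal form.
      The same happens for the filtration in \<open>lev\<close>, whose second conjunct feeds the
      next letter.\<close>
    have add: "\<phi> (word_value F w) (u + v) = \<phi> (word_value F w) u + \<phi> (word_value F w) v"
      if "fst ` set w \<subseteq> X" for w u v
      using that
    proof (induction w)
      case (Cons l w)
      then obtain x and e :: int where "x \<in> X" "letter_value l = x [^] e" using letter[of l] by auto
      moreover from this have "\<phi> (x [^] e \<otimes> word_value F w) v =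
          transvection (P x) e (\<phi> (word_value F w) v)" for v
        using Cons.prems basis_subset by (subst mult) (auto simp: int_pow)
      moreover have "\<phi> (word_value F w) (u + v) = \<phi> (word_value F w) u + \<phi> (word_value F w) v"
        by (rule Cons.IH) (use Cons.prems in simp)
      ultimately show ?case by (simp only: word_value_Cons transvection_linear)
    qed (simp add: one)
    show "\<phi> g (u + v) = \<phi> g u + \<phi> g v" if "g \<in> carrier F" for g u v
      using add[OF nf_letters[OF that]] that by simp
    have lev: "\<phi> (word_value F w) v - v \<in> coord_filtration q n (m - 1) \<and>
        \<phi> (word_value F w) v \<in> coord_filtration q n m"
      if "fst ` set w \<subseteq> X" "v \<in> coord_filtration q n m" for w v m
      using that
    proof (induction w)
      case Nil
      then show ?case by (simp add: one) (simp add: coord_filtration_def)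
    next
      case (Cons l w)
      let ?v = "\<phi> (word_value F w) v"
      obtain x and e :: int where x: "x \<in> X" "letter_value l = x [^] e"
        using letter[of l] Cons.prems by auto
      have eq: "\<phi> (word_value F (l # w)) v = transvection (P x) e ?v"
        unfolding word_value_Cons x(2) using Cons.prems basis_subset x(1)
        by (subst mult) (auto simp: int_pow)
      have "?v - v \<in> coord_filtration q n (m - 1)" "?v \<in> coord_filtration q n m"
        using Cons.IH[OF _ Cons.prems(2)] Cons.prems(1) by (simp_all only: list.set image_insert insert_subset)
      moreover from this have "transvection (P x) e ?v - ?v \<in> coord_filtration q n (m - 1)"
        using transvection_level[OF P(1)] by blast
      ultimately have "(transvection (P x) e ?v - ?v) + (?v - v) \<in> coord_filtration q n (m - 1)"
        by (intro coord_filtration_add)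
      then have 1: "transvection (P x) e ?v - v \<in> coord_filtration q n (m - 1)"
        by (simp only: diff_add_cancel add_diff_eq)
      have "(transvection (P x) e ?v - v) + v \<in> coord_filtration q n m"
        by (rule coord_filtration_add[OF coord_filtration_mono[OF 1] Cons.prems(2)]) simp
      then have "transvection (P x) e ?v \<in> coord_filtration q n m"
        by (simp only: diff_add_cancel)
      with 1 show ?case unfolding eq by (rule conjI)
    qed
    show "\<phi> g v - v \<in> coord_filtration q n (m - 1)"
      if "g \<in> carrier F" "v \<in> coord_filtration q n m" for g v m
      using lev[OF nf_letters[OF that(1)] that(2)] that(1) by simp
  qed
  then interpret u: unipotent_action F \<phi> q n .
  obtain N :: "nat monoid" and \<psi> where N: "nilpotent_group N" "finite (carrier N)" "\<psi> \<in> hom F N"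
    "\<And>x. x \<in> carrier F \<Longrightarrow> \<psi> x [^]\<^bsub>N\<^esub> (q ^ n) = \<one>\<^bsub>N\<^esub>"
    "\<And>g v. g \<in> carrier F \<Longrightarrow> \<psi> g = \<one>\<^bsub>N\<^esub> \<Longrightarrow> \<phi> g v - v \<in> coord_filtration q n 0"
    using u.finite_nilpotent_quotient by blast
  show thesis
  proof (rule that[OF N(1-3)])
    show "\<psi> x [^]\<^bsub>N\<^esub> (p ^ (nat \<bar>E\<bar> * n)) = \<one>\<^bsub>N\<^esub>" if "x \<in> carrier F" for x
      using N(4)[OF that] by (simp add: q_def power_mult)
    show "\<psi> g \<noteq> \<one>\<^bsub>N\<^esub>"
    proof
      assume "\<psi> g = \<one>\<^bsub>N\<^esub>"
      from N(5)[OF g(1) this, of d] have "int q dvd \<phi> g d 0 - d 0"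
        by (simp add: coord_filtration_def)
      moreover have "\<phi> g d 0 = E" using coeff[of "[]" s] s(2) by (simp add: E_def)
      ultimately have "int q dvd E" using n by (simp add: d_def)
      then have "\<bar>int q\<bar> \<le> \<bar>E\<bar>" by (rule dvd_imp_le_int[OF E])
      with \<open>nat \<bar>E\<bar> < q\<close> show False by linarith
    qed
  qed
qed

end

section \<open>Cyclically reduced words and centralizers\<close>

context based_free_group
begin

text \<open>Conjugation is an automorphism. It is applied to the basis so that u can acquire a
  shorter spelling while the element itself stays fixed.\<close>

lemma free_basis_conj:
  assumes c: "c \<in> carrier F"
  shows "based_free_group F ((\<lambda>x. c \<otimes> x \<otimes> inv c) ` X)"
    and "\<And>w. fst ` set w \<subseteq> X \<Longrightarrow>
      word_value F (map (apfst (\<lambda>x. c \<otimes> x \<otimes> inv c)) w) = c \<otimes> word_value F w \<otimes> inv c"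
    and "\<And>w. w \<in> reduced_words X \<Longrightarrow>
      map (apfst (\<lambda>x. c \<otimes> x \<otimes> inv c)) w \<in> reduced_words ((\<lambda>x. c \<otimes> x \<otimes> inv c) ` X)"
proof -
  let ?f = "\<lambda>x. c \<otimes> x \<otimes> inv c"
  let ?m = "map (apfst ?f)"
  have f_mult: "?f (a \<otimes> b) = ?f a \<otimes> ?f b" if "a \<in> carrier F" "b \<in> carrier F" for a b
    using c that by (simp add: m_assoc) (simp flip: m_assoc)
  have f_inv: "?f (inv a) = inv (?f a)" if "a \<in> carrier F" for a
    using c that by (simp add: inv_mult_group m_assoc)
  have f_inj: "inj_on ?f (carrier F)"
    using c by (auto intro!: inj_onI)
  have f_surj: "?f ` carrier F = carrier F"
  proof
    show "carrier F \<subseteq> ?f ` carrier F"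
    proof
      fix g assume g: "g \<in> carrier F"
      have "g = ?f (inv c \<otimes> g \<otimes> c)" using c g by (simp add: m_assoc) (simp flip: m_assoc)
      then show "g \<in> ?f ` carrier F" using c g by blast
    qed
  qed (use c in auto)
  show val: "word_value F (?m w) = ?f (word_value F w)" if "fst ` set w \<subseteq> X" for w
    using that
  proof (induction w)
    case Nil
    then show ?case using c by simp
  next
    case (Cons l w)
    have l: "fst l \<in> carrier F" using Cons.prems basis_subset by auto
    have "letter_value (apfst ?f l) = ?f (letter_value l)"
      using l f_inv by (cases l) (auto simp: letter_value_def)
    moreover have "?f (letter_value l \<otimes> word_value F w) = ?f (letter_value l) \<otimes> ?f (word_value F w)"
      by (rule f_mult) (use Cons.prems l in auto)
    ultimately show ?case
      using Cons by (simp add: word_value_Cons)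
  qed
  have f_X: "inj_on ?f X" using f_inj basis_subset by (rule inj_on_subset)
  have red: "?m w \<in> reduced_words (?f ` X) \<longleftrightarrow> w \<in> reduced_words X" if "fst ` set w \<subseteq> X" for w
  proof -
    have "successively (\<lambda>u v. v \<noteq> inv_letter u) (?m w) \<longleftrightarrow>
        successively (\<lambda>u v. apfst ?f v \<noteq> inv_letter (apfst ?f u)) w"
      by (simp add: successively_map)
    also have "\<dots> \<longleftrightarrow> successively (\<lambda>u v. v \<noteq> inv_letter u) w"
      by (rule successively_cong)
        (use that f_X in \<open>auto simp: inv_letter_def prod_eq_iff subset_eq dest: inj_onD\<close>)
    finally show ?thesis using that by (auto simp: reduced_words_iff image_image)
  qed
  show "?m w \<in> reduced_words (?f ` X)" if "w \<in> reduced_words X" for w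
    using that red reduced_words_subset by blast
  have "?m ` reduced_words X = reduced_words (?f ` X)"
  proof
    show "?m ` reduced_words X \<subseteq> reduced_words (?f ` X)"
      using red reduced_words_subset by blast
    show "reduced_words (?f ` X) \<subseteq> ?m ` reduced_words X"
    proof
      fix v assume v: "v \<in> reduced_words (?f ` X)"
      define w where "w = map (apfst (inv_into X ?f)) v"
      have fv: "fst l \<in> ?f ` X" if "l \<in> set v" for l using v that by (auto simp: reduced_words_iff)
      have "?m w = v" unfolding w_def map_map
        by (rule map_idI) (use fv f_inv_into_f[of _ ?f X] in \<open>simp add: prod_eq_iff\<close>)
      moreover have "fst ` set w \<subseteq> X"
        using fv inv_into_into[of _ ?f X] by (auto simp: w_def)
      ultimately show "v \<in> ?m ` reduced_words X" using red v by blast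
    qed
  qed
  moreover have "inj_on ?m (reduced_words X)"
  proof (rule inj_onI)
    fix v w assume vw: "v \<in> reduced_words X" "w \<in> reduced_words X" "?m v = ?m w"
    have "?f (word_value F v) = ?f (word_value F w)"
      using vw val reduced_words_subset by metis
    then have "word_value F v = word_value F w" using vw f_inj by (auto dest: inj_onD)
    then show "v = w" using vw nf_word_value by metis
  qed
  ultimately have 1: "bij_betw ?m (reduced_words X) (reduced_words (?f ` X))"
    by (simp add: bij_betw_def)
  have "bij_betw ?f (carrier F) (carrier F)" using f_inj f_surj by (simp add: bij_betw_def)
  from bij_betw_trans[OF word_value_bij this]
  have 2: "bij_betw (?f \<circ> word_value F) (reduced_words X) (carrier F)" .
  have eq: "(?f \<circ> word_value F) w = (word_value F \<circ> ?m) w" if "w \<in> reduced_words X" for w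
    unfolding comp_apply by (rule val[OF reduced_words_subset[OF that], symmetric])
  have "bij_betw (word_value F \<circ> ?m) (reduced_words X) (carrier F)"
    by (rule bij_betw_cong[THEN iffD1, OF eq 2])
  then have "bij_betw (word_value F) (reduced_words (?f ` X)) (carrier F)"
    using bij_betw_comp_iff[OF 1] by blast
  then show "based_free_group F (?f ` X)"
    using basis_subset c by unfold_locales (auto simp: free_basis_def)
qed

end

text \<open>Among all bases and all reduced spellings of u, take a shortest spelling. If it were l m
  l^-1, conjugating the basis by the value of l would spell u by a copy of m, which is two letters
  shorter.\<close>

lemma (in group) cyclically_reduced_basis:
  assumes "based_free_group G X" "u \<in> carrier G" "u \<noteq> \<one>"
  obtains Y w where "based_free_group G Y" "w \<in> reduced_words Y" "word_value G w = u" "w \<noteq> []"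
    "w @ w \<in> reduced_words Y"
proof -
  define Q where "Q p \<longleftrightarrow> based_free_group G (fst p) \<and> snd p \<in> reduced_words (fst p) \<and>
    word_value G (snd p) = u" for p
  have "Q (X, based_free_group.nf G X u)"
    using based_free_group.nf_reduced[OF assms(1,2)] based_free_group.word_value_nf[OF assms(1,2)]
      assms(1) by (simp add: Q_def)
  then obtain p where p: "Q p" "\<And>p'. Q p' \<Longrightarrow> length (snd p) \<le> length (snd p')"
    using ex_has_least_nat[of Q _ "\<lambda>p. length (snd p)"] by blast
  obtain Y w where Yw: "p = (Y, w)" by (cases p)
  have Y: "based_free_group G Y" and w: "w \<in> reduced_words Y" "word_value G w = u"
    using p(1) by (auto simp: Q_def Yw)
  interpret Y: based_free_group G Y by fact
  have ne: "w \<noteq> []" using w(2) assms(3) by auto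
  have "hd w \<noteq> inv_letter (last w)"
  proof
    assume eq: "hd w = inv_letter (last w)"
    \<comment> \<open>A letter differs from its inverse, so \<open>w\<close> has at least two
      letters and can be split at both ends.\<close>
    then have "last w \<noteq> hd w" by (metis inv_letter_simps(3))
    then obtain l m where lm: "w = l # m @ [inv_letter l]"
      using ne eq by (cases w; cases "tl w" rule: rev_cases) auto
    have m: "m \<in> reduced_words Y" and l: "fst l \<in> Y"
      using w(1) reduced_words_append[of "[l]" "m @ [inv_letter l]" Y]
        reduced_words_append[of m "[inv_letter l]" Y] by (auto simp: lm reduced_words_iff)
    let ?c = "letter_value l"
    let ?m = "map (apfst (\<lambda>x. ?c \<otimes> x \<otimes> inv ?c)) m"
    have c: "?c \<in> carrier G" using l by simp
    have lc: "fst l \<in> carrier G" using l Y.basis_subset by auto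
    have "u = ?c \<otimes> word_value G m \<otimes> inv ?c"
      using w(2) l lc m unfolding lm
      by (simp add: word_value_Cons Y.val_append reduced_words_subset m_assoc letter_value_inv_letter)
    then have "Q ((\<lambda>x. ?c \<otimes> x \<otimes> inv ?c) ` Y, ?m)"
      using Y.free_basis_conj[OF c] m reduced_words_subset[OF m] by (simp add: Q_def)
    from p(2)[OF this] show False by (simp add: Yw lm)
  qed
  then have "w @ w \<in> reduced_words Y" using w by (simp add: reduced_words_append)
  then show thesis using that Y w ne by blast
qed

section \<open>Powers and centralizers of cyclically reduced elements\<close>

locale cyclically_reduced = based_free_group +
  fixes w
  assumes w_nonempty: "w \<noteq> []" and ww: "w @ w \<in> reduced_words X"
begin

definition "u = word_value F w"

lemma w_reduced: "w \<in> reduced_words X"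
  using ww by (simp add: reduced_words_append)

lemma u_closed [simp]: "u \<in> carrier F"
  by (simp add: u_def w_reduced)

lemma nf_u: "nf u = w"
  by (simp add: u_def w_reduced)

lemma w_letters: "fst ` set w \<subseteq> X"
  using w_reduced reduced_words_subset by blast

lemma hd_w: "hd w \<noteq> inv_letter (last w)"
  using ww w_nonempty by (simp add: reduced_words_append)

text \<open>The first letter is carried through the induction because it decides the next
  seam.\<close>

lemma concat_replicate_reduced:
  "concat (replicate k w) \<in> reduced_words X \<and>
    (k > 0 \<longrightarrow> concat (replicate k w) \<noteq> [] \<and> hd (concat (replicate k w)) = hd w)"
  using hd_w w_nonempty w_reduced by (induction k) (auto simp: reduced_words_append hd_append)

lemma u_pow_word: "u [^] k = word_value F (concat (replicate k w))" for k :: nat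
proof (induction k)
  case (Suc k)
  have "u [^] Suc k = u \<otimes> u [^] k" by (simp only: nat_pow_Suc2[OF u_closed])
  also have "\<dots> = word_value F (w @ concat (replicate k w))"
    using reduced_words_subset[OF conjunct1[OF concat_replicate_reduced[of k]]] w_letters
    by (subst val_append) (simp_all add: u_def flip: Suc)
  finally show ?case by simp
qed simp

lemma nf_u_pow: "nf (u [^] k) = concat (replicate k w)" for k :: nat
  by (simp add: u_pow_word concat_replicate_reduced)

lemma length_concat_replicate [simp]: "length (concat (replicate k w)) = k * length w" for k
  by (induction k) auto

lemma u_pow_neq_one: "k > 0 \<Longrightarrow> u [^] k \<noteq> \<one>" for k :: nat
  using nf_u_pow[of k] w_nonempty by auto

lemma centralizer_cyclic:
  assumes g: "g \<in> carrier F" and comm: "g \<otimes> u = u \<otimes> g"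
  obtains v and i :: nat and m :: int where
    "v \<in> carrier F" "u = v [^] i" "g = v [^] m"
proof -
  \<comment> \<open>Cancellation against \<open>nf g\<close> consumes at most
    \<open>length (nf g)\<close> letters of the power. One copy of \<open>w\<close> more than that
    leaves an entire copy at the left end of \<open>G\<close>, and, multiplying in the other order,
    at its right end.\<close>
  define k where "k = Suc (length (nf g))"
  define W where "W = concat (replicate k w)"
  have W: "W \<in> reduced_words X" "nf (u [^] k) = W"
    by (simp_all add: W_def concat_replicate_reduced nf_u_pow)
  have lenW: "length W \<ge> length (nf g) + length w"
    using w_nonempty by (simp add: W_def k_def Suc_le_eq)
  have W_hd: "W = w @ concat (replicate (length (nf g)) w)" by (simp add: W_def k_def)
  have W_tl: "W = concat (replicate (length (nf g)) w) @ w"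
    unfolding W_def k_def replicate_Suc replicate_append_same[symmetric] by simp
  define G where "G = nf (u [^] k \<otimes> g)"
  have pow_comm: "u [^] k \<otimes> g = g \<otimes> u [^] k"
    using group_commutes_pow[OF comm[symmetric] u_closed g] by simp
  have "prefix w G"
  proof -
    obtain a c b where abc: "nf (u [^] k) = a @ c" "nf g = inv_word c @ b" "G = a @ b"
      using nf_mult_cancel[of "u [^] k" g] g unfolding G_def by (metis nat_pow_closed u_closed)
    have "length w \<le> length a"
      using lenW W(2) arg_cong[OF abc(1), of length] arg_cong[OF abc(2), of length] by simp
    moreover have "prefix w (a @ c)" unfolding abc(1)[symmetric] W(2) W_hd by simp
    ultimately have "prefix w a" using prefix_length_prefix[of w "a @ c" a] by simp
    then show ?thesis unfolding abc(3) by (rule prefix_prefix)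
  qed
  then obtain G1 where G1: "G = w @ G1" by (auto simp: prefix_def)
  have "suffix w G"
  proof -
    obtain a c b where abc: "nf g = a @ c" "nf (u [^] k) = inv_word c @ b" "G = a @ b"
      using nf_mult_cancel[of g "u [^] k"] g unfolding G_def pow_comm
      by (metis nat_pow_closed u_closed)
    have "length w \<le> length b"
      using lenW W(2) arg_cong[OF abc(1), of length] arg_cong[OF abc(2), of length] by simp
    moreover have "suffix w (inv_word c @ b)" unfolding abc(2)[symmetric] W(2) W_tl by (simp add: suffix_def)
    ultimately have "suffix w b" using suffix_length_suffix[of w "inv_word c @ b" b] by (simp add: suffix_def)
    then show ?thesis unfolding abc(3) by (rule suffix_appendI)
  qed
  then obtain G2 where G2: "G = G2 @ w" by (auto simp: suffix_def)
  have G: "G \<in> reduced_words X" "word_value F G = u [^] k \<otimes> g" using g by (simp_all add: G_def)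
  \<comment> \<open>As \<open>G\<close> begins and ends with \<open>w\<close>, both seams are that
    of \<open>w @ w\<close>, so both products are already reduced and equality in the group is
    equality of lists.\<close>
  have "w @ G \<in> reduced_words X"
    using G(1) ww w_nonempty unfolding G1 by (simp add: reduced_words_append)
  moreover have "G @ w \<in> reduced_words X"
    using G(1) ww w_nonempty unfolding G2 by (simp add: reduced_words_append)
  moreover have "word_value F (w @ G) = word_value F (G @ w)"
  proof -
    have "u \<otimes> (u [^] k \<otimes> g) = u [^] k \<otimes> g \<otimes> u"
      using g comm nat_pow_Suc2[OF u_closed, of k] by (simp add: m_assoc) (simp flip: m_assoc)
    then show ?thesis
      using G w_letters by (simp add: val_append reduced_words_subset u_def)
  qed
  ultimately have "w @ G = G @ w" by (metis nf_word_value)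
  then obtain i j z where z: "concat (replicate i z) = w" "concat (replicate j z) = G"
    using comm_append_are_replicate by blast
  have i: "i \<noteq> 0" using z(1) w_nonempty by (intro notI) simp
  have zX: "fst ` set z \<subseteq> X"
    using w_letters i unfolding z(1)[symmetric] by (cases i) auto
  define v where "v = word_value F z"
  have v: "v \<in> carrier F" using zX by (simp add: v_def)
  have pow: "word_value F (concat (replicate t z)) = v [^] t" for t
  proof (induction t)
    case (Suc t)
    have "fst ` set (concat (replicate t z)) \<subseteq> X"
      using zX by (cases "t = 0") (auto simp: set_concat)
    then have "word_value F (concat (replicate (Suc t) z)) = v \<otimes> v [^] t"
      using zX Suc by (simp add: val_append v_def)
    then show ?case by (simp only: nat_pow_Suc2[OF v])
  qed simp
  have uv: "u = v [^] i" using pow[of i] by (simp add: z u_def)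
  have "u [^] k \<otimes> g = v [^] j" using pow[of j] G(2) by (simp add: z)
  then have "g = inv (u [^] k) \<otimes> v [^] j"
    using g v by (simp add: inv_solve_left)
  also have "\<dots> = v [^] (- int (i * k) + int j)"
    unfolding uv nat_pow_pow[OF v] int_pow_mult[OF v] int_pow_neg_int[OF v] int_pow_int ..
  finally show thesis using that v uv by blast
qed

end

section \<open>Separating cyclic subgroups\<close>

text \<open>If no prime had larger multiplicity in i than in m, i would divide m. The exponent is
  written \<open>Suc k\<close> because p^k is the power of v that will be kept nontrivial.\<close>

lemma exists_separating_prime_power:
  fixes i m :: nat
  assumes "i \<noteq> 0" "\<not> i dvd m"
  obtains p k where "prime p" "p ^ Suc k dvd i" "\<not> p ^ Suc k dvd m"
proof -
  have m: "m \<noteq> 0" using assms(2) by (intro notI) simp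
  obtain p where p: "prime p" "\<not> multiplicity p i \<le> multiplicity p m"
    using multiplicity_le_imp_dvd[OF assms(1)] assms(2) by blast
  define k where "k = multiplicity p i - 1"
  have k: "multiplicity p i = Suc k" using p(2) by (simp add: k_def)
  have "\<not> p ^ Suc k dvd m"
    using p m k power_dvd_iff_le_multiplicity[of m p "Suc k"] by (auto simp: prime_nat_iff)
  then show thesis using that p(1) multiplicity_dvd[of p i] k by metis
qed

context cyclically_reduced
begin

theorem cyclic_subgroup_separable:
  assumes g: "g \<in> carrier F" "g \<notin> range (\<lambda>t::int. u [^] t)"
  obtains N :: "nat monoid" and \<psi> where "nilpotent_group N" "finite (carrier N)" "\<psi> \<in> hom F N"
    "\<psi> g \<notin> \<psi> ` range (\<lambda>t::int. u [^] t)"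
proof (cases "g \<otimes> u = u \<otimes> g")
  case False
  \<comment> \<open>If the image of g were that of a power of u, it would commute with the image of
    u. So any quotient in which this commutator survives separates; the prime 2 is an arbitrary
    choice.\<close>
  define d where "d = (g \<otimes> u) \<otimes> inv (u \<otimes> g)"
  have d: "d \<in> carrier F" using g by (simp add: d_def)
  have "d \<noteq> \<one>"
    using False g by (metis d_def inv_equality inv_inv inv_closed m_closed u_closed)
  obtain N :: "nat monoid" and \<psi> where N: "nilpotent_group N" "finite (carrier N)" "\<psi> \<in> hom F N"
    "\<psi> d \<noteq> \<one>\<^bsub>N\<^esub>"
    using residually_p[OF d \<open>d \<noteq> \<one>\<close> two_is_prime_nat] by metis
  interpret h: group_hom F N \<psi>
    using N by (simp add: group_hom_def group_hom_axioms_def group_axioms nilpotent_group_def)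
  have "\<psi> g \<notin> \<psi> ` range (\<lambda>t::int. u [^] t)"
  proof
    assume "\<psi> g \<in> \<psi> ` range (\<lambda>t::int. u [^] t)"
    then obtain t :: int where t: "\<psi> g = \<psi> (u [^] t)" by blast
    have "u [^] t \<otimes> u = u \<otimes> u [^] t"
      using int_pow_mult[OF u_closed, of t 1] int_pow_mult[OF u_closed, of 1 t] by (simp add: add.commute)
    then have "\<psi> (u [^] t \<otimes> u) = \<psi> (u \<otimes> u [^] t)" by simp
    then have "\<psi> (g \<otimes> u) = \<psi> (u \<otimes> g)" using g t by simp
    then have "\<psi> d = \<one>\<^bsub>N\<^esub>"
      using g h.hom_mult[of "g \<otimes> u" "inv (u \<otimes> g)"] h.hom_inv[of "u \<otimes> g"]
        h.H.r_inv[of "\<psi> (u \<otimes> g)"] unfolding d_def by simp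
    with N(4) show False by blast
  qed
  with N that show thesis by blast
next
  case True
  obtain v and i :: nat and m :: int where v: "v \<in> carrier F" "u = v [^] i" "g = v [^] m"
    using centralizer_cyclic[OF g(1) True] .
  have u1: "u \<noteq> \<one>" using u_pow_neq_one[of 1] by simp
  have i: "i \<noteq> 0" using u1 v(2) by (intro notI) simp
  have "\<not> i dvd nat \<bar>m\<bar>"
  proof
    assume "i dvd nat \<bar>m\<bar>"
    then have "int i dvd m" by simp
    then obtain t where "m = int i * t" by (elim dvdE)
    then have "g = u [^] t" using v by (simp add: int_pow_pow flip: int_pow_int)
    with g(2) show False by blast
  qed
  then obtain p k where p: "prime p" "p ^ Suc k dvd i" "\<not> p ^ Suc k dvd nat \<bar>m\<bar>"
    using exists_separating_prime_power[OF i] by blast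
  \<comment> \<open>Survival of \<open>h\<close> means that the order of the image of v, a power of
    p, does not divide p^k; so p^(k+1) divides it. If g and u^t had equal images, this order would
    divide m - i t, and p^(k+1) would divide m together with i.\<close>
  define h where "h = v [^] (p ^ k)"
  have h: "h \<in> carrier F" using v by (simp add: h_def)
  have "h \<noteq> \<one>"
  proof
    assume "h = \<one>"
    obtain t where "i = p ^ k * t" using p(2) by (metis dvdE dvd_trans le_imp_power_dvd lessI less_imp_le)
    then have "u = h [^] t" using v by (simp add: h_def nat_pow_pow)
    with \<open>h = \<one>\<close> u1 show False by simp
  qed
  obtain N :: "nat monoid" and \<psi> and e :: nat where N: "nilpotent_group N" "finite (carrier N)"
    "\<psi> \<in> hom F N" "\<psi> h \<noteq> \<one>\<^bsub>N\<^esub>" "\<And>x. x \<in> carrier F \<Longrightarrow> \<psi> x [^]\<^bsub>N\<^esub> (p ^ e) = \<one>\<^bsub>N\<^esub>"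
    using residually_p[OF h \<open>h \<noteq> \<one>\<close> p(1)] by metis
  interpret h: group_hom F N \<psi>
    using N by (simp add: group_hom_def group_hom_axioms_def group_axioms nilpotent_group_def)
  have "\<psi> g \<notin> \<psi> ` range (\<lambda>t::int. u [^] t)"
  proof
    assume "\<psi> g \<in> \<psi> ` range (\<lambda>t::int. u [^] t)"
    then obtain t :: int where t: "\<psi> g = \<psi> (u [^] t)" by blast
    have pv: "\<psi> v \<in> carrier N" using v by simp
    have "u [^] t = v [^] (int i * t)" using v by (simp add: int_pow_pow flip: int_pow_int)
    then have "\<psi> v [^]\<^bsub>N\<^esub> m = \<psi> v [^]\<^bsub>N\<^esub> (int i * t)"
      using t v by (simp add: h.hom_int_pow)
    then have "\<psi> v [^]\<^bsub>N\<^esub> (m - int i * t) = \<one>\<^bsub>N\<^esub>"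
      using pv by (simp add: h.H.int_pow_diff)
    then have 1: "int (h.H.ord (\<psi> v)) dvd m - int i * t" using pv h.H.int_pow_eq_id by blast
    have "h.H.ord (\<psi> v) dvd p ^ e" using N(5)[OF v(1)] pv h.H.pow_eq_id by blast
    then obtain j where j: "h.H.ord (\<psi> v) = p ^ j" using divides_primepow_nat[OF p(1)] by blast
    have "\<not> p ^ j dvd p ^ k"
      using N(4) v(1) h.H.pow_eq_id[OF pv, of "p ^ k"] by (simp add: h_def h.hom_nat_pow j)
    then have "\<not> j \<le> k" using le_imp_power_dvd by blast
    then have "Suc k \<le> j" by simp
    then have "int (p ^ Suc k) dvd int (p ^ j)" by (simp add: le_imp_power_dvd del: power_Suc)
    then have "int (p ^ Suc k) dvd m - int i * t" using 1 unfolding j by (rule dvd_trans)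
    moreover have "int (p ^ Suc k) dvd int i * t"
      by (rule dvd_mult2) (use p(2) in \<open>simp only: of_nat_dvd_iff\<close>)
    ultimately have "int (p ^ Suc k) dvd (m - int i * t) + int i * t" by (rule dvd_add)
    then have "int (p ^ Suc k) dvd m" by simp
    with p(3) show False by (simp del: power_Suc of_nat_power)
  qed
  with N that show thesis by blast
qed

end

section \<open>The ping-pong lemma\<close>

context group
begin

lemma tagged_value_Nil [simp]: "tagged_value G [] = \<one>"
  by (simp add: tagged_value_def)

lemma tagged_value_Cons [simp]: "tagged_value G (t # w) = case_sum id id t \<otimes> tagged_value G w"
  by (simp add: tagged_value_def)

lemma alternating_words_Nil [simp]: "[] \<in> alternating_words G A B"
  by (simp add: alternating_words_def)

lemma alternating_words_Cons:
  "t # w \<in> alternating_words G A B \<longleftrightarrow>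
     t \<in> (A - {\<one>}) <+> (B - {\<one>}) \<and> w \<in> alternating_words G A B \<and>
     (w \<noteq> [] \<longrightarrow> isl t \<noteq> isl (hd w))"
  by (cases w) (auto simp: alternating_words_def)

lemma tagged_value_closed:
  assumes "subgroup A G" "subgroup B G" "w \<in> alternating_words G A B"
  shows "tagged_value G w \<in> carrier G"
  using assms(3)
  by (induction w)
    (use assms(1,2) in \<open>auto simp: alternating_words_Cons dest: subgroup.mem_carrier\<close>)

text \<open>One proof serves both factors: \<open>con\<close> is \<open>Inl\<close> or
  \<open>Inr\<close>, \<open>C\<close> the corresponding factor and \<open>s\<close> its tag. The
  new element is prepended, or merged with a first letter from the same factor, which may
  cancel.\<close>

lemma tagged_values_left_mult:
  assumes A: "subgroup A G" and B: "subgroup B G" and C: "subgroup C G"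
    and con: "\<And>c. case_sum id id (con c) = c" "\<And>c. isl (con c) = s"
      "\<And>c. con c \<in> (A - {\<one>}) <+> (B - {\<one>}) \<longleftrightarrow> c \<in> C - {\<one>}"
      "\<And>t. isl t = s \<Longrightarrow> \<exists>c. t = con c"
    and c: "c \<in> C" and w: "w \<in> alternating_words G A B"
  shows "c \<otimes> tagged_value G w \<in> tagged_value G ` alternating_words G A B"
proof -
  have cc: "c \<in> carrier G" using C c by (rule subgroup.mem_carrier)
  note wc = tagged_value_closed[OF A B w]
  consider "c = \<one>" | "c \<noteq> \<one>" "w = [] \<or> isl (hd w) \<noteq> s" | "w \<noteq> []" "isl (hd w) = s" by blast
  then show ?thesis
  proof cases
    case 1
    then show ?thesis using w wc by simp
  next
    case 2
    then have "con c # w \<in> alternating_words G A B"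
      using c w con(2,3) by (auto simp: alternating_words_Cons)
    then show ?thesis by (intro image_eqI) (simp_all add: con(1))
  next
    case 3
    then obtain d v where v: "w = con d # v" using con(4) by (metis list.collapse)
    have d: "d \<in> C" and vW: "v \<in> alternating_words G A B" and alt: "v \<noteq> [] \<longrightarrow> isl (hd v) \<noteq> s"
      using w con(2,3) by (auto simp: v alternating_words_Cons)
    have dc: "d \<in> carrier G" using C d by (rule subgroup.mem_carrier)
    note vc = tagged_value_closed[OF A B vW]
    have eq: "c \<otimes> tagged_value G w = (c \<otimes> d) \<otimes> tagged_value G v"
      using cc dc vc by (simp add: v con(1) m_assoc)
    have cd: "c \<otimes> d \<in> C" using C c d by (rule subgroup.m_closed)
    show ?thesis
    proof (cases "c \<otimes> d = \<one>")
      case True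
      then show ?thesis unfolding eq using vW vc by simp
    next
      case False
      then have "con (c \<otimes> d) # v \<in> alternating_words G A B"
        using cd vW alt con(2,3) by (auto simp: alternating_words_Cons)
      then show ?thesis unfolding eq by (intro image_eqI) (simp_all add: con(1))
    qed
  qed
qed

text \<open>The orbit of the unit is followed. \<open>BS\<close> puts the unit and the one-letter
  words from \<open>B\<close> outside \<open>S\<close>; by induction a word has its value in
  \<open>S\<close> exactly if its first letter comes from \<open>A\<close>.\<close>

lemma ping_pong:
  assumes A: "subgroup A G" and B: "subgroup B G"
    and SA: "\<And>a x. a \<in> A - {\<one>} \<Longrightarrow> x \<in> carrier G - S \<Longrightarrow> a \<otimes> x \<in> S"
    and SB: "\<And>b x. b \<in> B - {\<one>} \<Longrightarrow> x \<in> carrier G \<inter> S \<Longrightarrow> b \<otimes> x \<notin> S"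
    and BS: "B \<inter> S = {}"
  shows "internal_free_product (G\<lparr>carrier := generate G (A \<union> B)\<rparr>) A B"
proof -
  let ?W = "alternating_words G A B"
  let ?v = "tagged_value G"
  let ?K = "generate G (A \<union> B)"
  have AB: "A \<union> B \<subseteq> carrier G" using A B subgroup.subset by blast
  note closed = tagged_value_closed[OF A B]
  have one_S: "\<one> \<notin> S" using BS subgroup.one_closed[OF B] by blast
  have S_iff: "?v w \<in> S \<longleftrightarrow> w \<noteq> [] \<and> isl (hd w)" if "w \<in> ?W" for w
    using that
  proof (induction w)
    case Nil
    then show ?case using one_S by simp
  next
    case (Cons t w)
    then have w: "w \<in> ?W" "?v w \<in> carrier G" by (auto simp: alternating_words_Cons closed)
    show ?case
    proof (cases t)
      case (Inl a)
      then show ?thesis using Cons w SA[of a "?v w"] by (auto simp: alternating_words_Cons)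
    next
      case (Inr b)
      then have b: "b \<in> B - {\<one>}" using Cons.prems by (auto simp: alternating_words_Cons)
      show ?thesis
      proof (cases "w = []")
        case True
        then show ?thesis using b Inr BS subgroup.mem_carrier[OF B] by auto
      next
        case False
        then show ?thesis using Cons w Inr SB[OF b, of "?v w"] by (auto simp: alternating_words_Cons)
      qed
    qed
  qed
  \<comment> \<open>\<open>S\<close> does not distinguish the empty word from one beginning in
    \<open>B\<close>. If b w = 1, the value of w is b^-1, hence in \<open>B\<close> and outside
    \<open>S\<close>; so w is empty and b trivial.\<close>
  have neq1: "?v (Inr b # w) \<noteq> \<one>" if "Inr b # w \<in> ?W" for b w
  proof
    assume 1: "?v (Inr b # w) = \<one>"
    have b: "b \<in> B" "b \<noteq> \<one>" and w: "w \<in> ?W" "w \<noteq> [] \<longrightarrow> isl (hd w)"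
      using that by (auto simp: alternating_words_Cons)
    have bc: "b \<in> carrier G" using B b(1) by (rule subgroup.mem_carrier)
    have "b \<otimes> ?v w = \<one>" using 1 by simp
    then have "?v w = inv b"
      using inv_equality[OF inv_comm, of b "?v w"] bc closed[OF w(1)] by simp
    then have "?v w \<in> B" using subgroup.m_inv_closed[OF B b(1)] by simp
    then have "w = []" using BS S_iff[OF w(1)] w(2) by blast
    with 1 b(2) bc show False by simp
  qed
  have "v = w" if "v \<in> ?W" "w \<in> ?W" "?v v = ?v w" for v w
    using that
  proof (induction v arbitrary: w)
    case Nil
    show ?case
    proof (rule ccontr)
      assume "[] \<noteq> w"
      then obtain t w' where w: "w = t # w'" by (cases w) auto
      show False
      proof (cases t)
        case (Inl a)
        then show False using S_iff[OF Nil.prems(2)] Nil.prems(3) one_S by (simp add: w)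
      next
        case (Inr b)
        then show False using neq1[of b w'] Nil by (auto simp: w)
      qed
    qed
  next
    case (Cons t v)
    have S_eq: "isl t \<longleftrightarrow> w \<noteq> [] \<and> isl (hd w)"
      using S_iff[OF Cons.prems(1)] S_iff[OF Cons.prems(2)] Cons.prems(3) by simp
    obtain t' w' where w: "w = t' # w'"
    proof (cases w)
      case Nil
      then obtain b where "t = Inr b" using S_eq by (cases t) auto
      then show thesis using neq1[of b v] Cons.prems Nil by simp
    qed (use that in blast)
    have vW: "v \<in> ?W" "v \<noteq> [] \<longrightarrow> isl t \<noteq> isl (hd v)"
      and wW: "w' \<in> ?W" "w' \<noteq> [] \<longrightarrow> isl t' \<noteq> isl (hd w')"
      using Cons.prems by (auto simp: w alternating_words_Cons)
    note vc = closed[OF vW(1)] and wc = closed[OF wW(1)]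
    obtain c d where cd: "(t = Inl c \<and> t' = Inl d \<and> c \<in> A \<and> d \<in> A) \<or>
        (t = Inr c \<and> t' = Inr d \<and> c \<in> B \<and> d \<in> B)"
      using S_eq Cons.prems(1,2) by (cases t; cases t') (auto simp: w alternating_words_Cons)
    then have c: "c \<in> carrier G" and d: "d \<in> carrier G" using AB by auto
    have eq: "c \<otimes> ?v v = d \<otimes> ?v w'" using Cons.prems(3) cd by (auto simp: w)
    then have eq': "(inv d \<otimes> c) \<otimes> ?v v = ?v w'"
      using c d vc wc by (simp add: m_assoc) (simp flip: m_assoc)
    \<comment> \<open>Both first letters come from the same factor. If they differ, d^-1 c is a
      nontrivial letter in front of v whose product has the value of w'. For \<open>A\<close> the
      two sides disagree about \<open>S\<close>; for \<open>B\<close> agreement leaves only an empty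
      w', which \<open>neq1\<close> excludes.\<close>
    show ?case
    proof (cases "c = d")
      case True
      then have "?v v = ?v w'" using eq c vc wc by simp
      then show ?thesis using Cons.IH[OF vW(1) wW(1)] True cd by (auto simp: w)
    next
      case False
      then have ne: "inv d \<otimes> c \<noteq> \<one>"
        using c d inv_equality by (metis inv_closed inv_inv)
      from cd show ?thesis
      proof
        assume *: "t = Inl c \<and> t' = Inl d \<and> c \<in> A \<and> d \<in> A"
        then have "inv d \<otimes> c \<in> A - {\<one>}"
          using ne subgroup.m_closed[OF A] subgroup.m_inv_closed[OF A] by simp
        moreover have "?v v \<notin> S" using S_iff[OF vW(1)] vW(2) * by auto
        ultimately have "?v w' \<in> S" using SA[of "inv d \<otimes> c" "?v v"] vc by (simp add: eq')
        then show ?thesis using S_iff[OF wW(1)] wW(2) * by auto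
      next
        assume *: "t = Inr c \<and> t' = Inr d \<and> c \<in> B \<and> d \<in> B"
        then have "inv d \<otimes> c \<in> B - {\<one>}"
          using ne subgroup.m_closed[OF B] subgroup.m_inv_closed[OF B] by simp
        then have b: "Inr (inv d \<otimes> c) # v \<in> ?W"
          using vW * by (auto simp: alternating_words_Cons)
        have "?v w' \<notin> S" using S_iff[OF b] by (simp add: eq')
        then have "w' = []" using S_iff[OF wW(1)] wW(2) * by auto
        then have "?v (Inr (inv d \<otimes> c) # v) = \<one>" using eq' by simp
        with neq1[OF b] show ?thesis by blast
      qed
    qed
  qed
  then have inj: "inj_on ?v ?W" by (rule inj_onI)
  have left: "g \<otimes> x \<in> ?v ` ?W" if g: "g \<in> A \<union> B" and x: "x \<in> ?v ` ?W" for g x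
  proof -
    obtain w where w: "w \<in> ?W" "x = ?v w" using x by blast
    consider "g \<in> A" | "g \<in> B" using g by blast
    then show ?thesis
    proof cases
      case 1
      show ?thesis unfolding w(2)
        by (rule tagged_values_left_mult[OF A B A, where con = Inl and s = True])
          (use 1 w in \<open>auto simp: isl_def\<close>)
    next
      case 2
      show ?thesis unfolding w(2)
        by (rule tagged_values_left_mult[OF A B B, where con = Inr and s = False])
          (use 2 w sum.collapse(2) in \<open>auto simp: isl_def\<close>, metis sum.exhaust)
    qed
  qed
  have carr: "?v ` ?W \<subseteq> carrier G" using closed by blast
  have gen_left: "g \<otimes> x \<in> ?v ` ?W" if "g \<in> ?K" "x \<in> ?v ` ?W" for g x
    using that
  proof (induction arbitrary: x rule: generate.induct)
    case one
    then show ?case using carr by auto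
  next
    case (incl h)
    then show ?case by (rule left)
  next
    case (inv h)
    then have "inv h \<in> A \<union> B"
      using subgroup.m_inv_closed[OF A] subgroup.m_inv_closed[OF B] by blast
    then show ?case using inv.prems by (rule left)
  next
    case (eng h1 h2)
    have "h1 \<in> carrier G" "h2 \<in> carrier G" "x \<in> carrier G"
      using eng.hyps generate_in_carrier[OF AB] eng.prems carr by auto
    then show ?case using eng.IH eng.prems by (simp add: m_assoc)
  qed
  have "?v ` ?W = ?K"
  proof
    show "?K \<subseteq> ?v ` ?W"
    proof
      fix g assume g: "g \<in> ?K"
      have "\<one> \<in> ?v ` ?W" by (rule image_eqI[of _ _ "[]"]) simp_all
      from gen_left[OF g this] show "g \<in> ?v ` ?W"
        using generate_in_carrier[OF AB g] by simp
    qed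
    have "?v w \<in> ?K" if "w \<in> ?W" for w
      using that
    proof (induction w)
      case (Cons t w)
      then have "case_sum id id t \<in> ?K" "?v w \<in> ?K"
        by (auto simp: alternating_words_Cons intro: generate.incl)
      then show ?case by (simp add: generate.eng)
    qed (simp add: generate.one)
    then show "?v ` ?W \<subseteq> ?K" by blast
  qed
  with inj have "bij_betw ?v ?W ?K" by (simp add: bij_betw_def)
  moreover have "subgroup A (G\<lparr>carrier := ?K\<rparr>)" "subgroup B (G\<lparr>carrier := ?K\<rparr>)"
    by (rule subgroup_incl[OF _ generate_is_subgroup[OF AB]];
        use A B in \<open>auto intro: generate.incl\<close>)+
  moreover have "tagged_value (G\<lparr>carrier := ?K\<rparr>) = ?v"
    by (simp add: fun_eq_iff tagged_value_def)
  ultimately show ?thesis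
    by (simp add: internal_free_product_def alternating_words_def)
qed

end

section \<open>Cycles in Schreier graphs\<close>

text \<open>\<open>prefixes_distinct\<close> says that the cosets K p_i of the proper prefixes p_i
  of \<open>w\<close> differ. The index 0 is included, so no nonempty proper prefix lies in
  \<open>K\<close>.\<close>

locale cycle_in_schreier_graph = cyclically_reduced +
  fixes K
  assumes K: "subgroup K F" and u_in_K: "u \<in> K"
    and prefixes_distinct: "\<And>i j. i < length w \<Longrightarrow> j < length w \<Longrightarrow> i \<noteq> j \<Longrightarrow>
      word_value F (take i w) \<otimes> inv (word_value F (take j w)) \<notin> K"
begin

sublocale K: subgroup K F by (rule K)

definition a where "a = last w"

text \<open>
  A word read from the vertex \<open>K s\<close> of the Schreier graph of \<open>K\<close> crosses the last edge of the
  cycle \<open>w\<close> at \<open>K\<close>; that edge is labelled \<open>a\<close> and ends in \<open>K\<close>.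
\<close>
definition crosses :: "'a \<Rightarrow> 'a \<times> bool \<Rightarrow> bool" where
  "crosses s l \<longleftrightarrow> l = a \<and> s \<otimes> letter_value l \<in> K \<or> l = inv_letter a \<and> s \<in> K"

fun avoids :: "'a \<Rightarrow> ('a \<times> bool) list \<Rightarrow> bool" where
  "avoids s [] \<longleftrightarrow> True"
| "avoids s (l # z) \<longleftrightarrow> \<not> crosses s l \<and> avoids (s \<otimes> letter_value l) z"

definition "avoiding = {g \<in> K. avoids \<one> (nf g)}"

text \<open>The asymmetry fits the two directions. If \<open>nf g\<close> does not begin with the
  inverse of \<open>a\<close>, nothing cancels in front of it and u g shows all of \<open>w\<close>.
  If it does not begin with \<open>w\<close>, the inverse of \<open>w\<close> cannot cancel
  completely, and its first letter, the inverse of \<open>a\<close>, survives in u^-1 g.\<close>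

definition "pong = {g. prefix w (nf g) \<or> prefix [inv_letter a] (nf g)}"

lemma w_split: "w = butlast w @ [a]"
  using w_nonempty by (simp add: a_def)

lemma letters [simp]: "fst a \<in> X" "fst ` set (butlast w) \<subseteq> X" "fst ` set (take i w) \<subseteq> X"
proof -
  show "fst a \<in> X" "fst ` set (butlast w) \<subseteq> X"
    using w_letters by (subst (asm) w_split, auto)+
  show "fst ` set (take i w) \<subseteq> X" using w_letters set_take_subset[of i w] by blast
qed

lemma u_eq: "u = word_value F (butlast w) \<otimes> letter_value a"
proof -
  have "u = word_value F (butlast w @ [a])" using w_split by (simp add: u_def)
  then show ?thesis by (simp add: val_append word_value_Cons del: append_butlast_last_id)
qed

lemma K_mult_left_iff: "k \<in> K \<Longrightarrow> s \<in> carrier F \<Longrightarrow> k \<otimes> s \<in> K \<longleftrightarrow> s \<in> K"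
proof
  assume k: "k \<in> K" and s: "s \<in> carrier F" and "k \<otimes> s \<in> K"
  then have "inv k \<otimes> (k \<otimes> s) \<in> K" by simp
  then show "s \<in> K" using k s by (simp flip: m_assoc)
qed simp

section \<open>Paths that avoid the last edge of the cycle\<close>

lemma avoids_append:
  "s \<in> carrier F \<Longrightarrow> fst ` set y \<subseteq> X \<Longrightarrow> fst ` set z \<subseteq> X \<Longrightarrow>
    avoids s (y @ z) \<longleftrightarrow> avoids s y \<and> avoids (s \<otimes> word_value F y) z"
  by (induction y arbitrary: s) (auto simp: word_value_Cons m_assoc)

text \<open>Only the vertex K s matters, not its representative; this allows loops at
  \<open>K\<close> to be composed.\<close>

lemma avoids_left:
  "k \<in> K \<Longrightarrow> s \<in> carrier F \<Longrightarrow> fst ` set z \<subseteq> X \<Longrightarrow> avoids (k \<otimes> s) z \<longleftrightarrow> avoids s z"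
  by (induction z arbitrary: s) (auto simp: crosses_def m_assoc K_mult_left_iff)

lemma avoids_K: "k \<in> K \<Longrightarrow> fst ` set z \<subseteq> X \<Longrightarrow> avoids k z \<longleftrightarrow> avoids \<one> z"
  using avoids_left[of k \<one> z] by simp

text \<open>Reading the edge backwards exchanges the two disjuncts of \<open>crosses\<close>, so a
  path and its reverse use the edge equally.\<close>

lemma crosses_inv_letter:
  assumes "s \<in> carrier F" "fst l \<in> X"
  shows "crosses (s \<otimes> letter_value l) (inv_letter l) \<longleftrightarrow> crosses s l"
  using assms basis_subset
  by (auto simp: crosses_def inv_letter_eq_iff letter_value_inv_letter m_assoc subset_eq)

lemma avoids_inv_word:
  "s \<in> carrier F \<Longrightarrow> fst ` set z \<subseteq> X \<Longrightarrow>
    avoids (s \<otimes> word_value F z) (inv_word z) \<longleftrightarrow> avoids s z"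
proof (induction z arbitrary: s)
  case (Cons l z)
  have z: "fst l \<in> X" "fst ` set z \<subseteq> X" using Cons.prems by auto
  have "avoids (s \<otimes> word_value F (l # z)) (inv_word (l # z)) \<longleftrightarrow>
      avoids (s \<otimes> letter_value l \<otimes> word_value F z) (inv_word z) \<and>
      \<not> crosses (s \<otimes> letter_value l) (inv_letter l)"
    using Cons.prems z
    by (simp add: word_value_Cons avoids_append val_inv_word m_assoc)
  then show ?case using Cons.IH[of "s \<otimes> letter_value l"] Cons.prems z
    by (auto simp: crosses_inv_letter)
qed simp

lemma nf_letter_mult:
  assumes "fst l \<in> X" "h \<in> carrier F"
  shows "nf (letter_value l \<otimes> h) = l # nf h \<or> nf h = inv_letter l # nf (letter_value l \<otimes> h)"
proof -
  have "[l] \<in> reduced_words X" using assms(1) by (simp add: reduced_words_iff)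
  then have l: "nf (letter_value l) = [l]"
    using nf_word_value[of "[l]"] assms(1) by (simp add: word_value_Cons)
  obtain b c d where "nf (letter_value l) = b @ c" "nf h = inv_word c @ d"
    "nf (letter_value l \<otimes> h) = b @ d"
    using nf_mult_cancel[of "letter_value l" h] assms by (metis letter_closed)
  then show ?thesis unfolding l by (auto simp: Cons_eq_append_conv)
qed

text \<open>Free reduction removes backtracking and adds no edge. Hence any avoiding word, reduced
  or not, certifies membership in \<open>avoiding\<close>.\<close>

lemma avoids_nf:
  "s \<in> carrier F \<Longrightarrow> fst ` set z \<subseteq> X \<Longrightarrow> avoids s z \<Longrightarrow> avoids s (nf (word_value F z))"
proof (induction z arbitrary: s)
  case (Cons l z)
  let ?h = "word_value F z"
  have z: "fst l \<in> X" "fst ` set z \<subseteq> X" using Cons.prems by auto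
  have IH: "avoids (s \<otimes> letter_value l) (nf ?h)" using Cons z by simp
  have h: "?h \<in> carrier F" using z by simp
  from nf_letter_mult[OF z(1) h] show ?case
  proof
    assume "nf (letter_value l \<otimes> ?h) = l # nf ?h"
    then show ?thesis using IH Cons.prems by (simp add: word_value_Cons)
  next
    assume eq: "nf ?h = inv_letter l # nf (letter_value l \<otimes> ?h)"
    have "s \<otimes> letter_value l \<otimes> letter_value (inv_letter l) = s"
      using z Cons.prems(1) basis_subset by (simp add: letter_value_inv_letter m_assoc subset_eq)
    then show ?thesis using IH unfolding eq by (simp add: word_value_Cons)
  qed
qed simp

lemma take_in_K:
  assumes "i < length w" "word_value F (take i w) \<in> K"
  shows "i = 0"
proof (rule ccontr)
  assume "i \<noteq> 0"
  then show False using prefixes_distinct[of i 0] assms w_nonempty by simp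
qed

text \<open>A forward crossing would bring the path back to \<open>K\<close> too early. A backward
  one starts at \<open>K\<close>, hence at index 0, and would make the first letter of
  \<open>w\<close> inverse to its last.\<close>

lemma avoids_take: "i < length w \<Longrightarrow> avoids \<one> (take i w)"
proof (induction i)
  case (Suc i)
  have i: "i < length w" using Suc.prems by simp
  have li: "fst (w ! i) \<in> X" using w_letters i by (auto simp: subset_eq)
  have S: "take (Suc i) w = take i w @ [w ! i]" using i by (rule take_Suc_conv_app_nth)
  have "\<not> crosses (word_value F (take i w)) (w ! i)"
  proof
    assume "crosses (word_value F (take i w)) (w ! i)"
    then consider "word_value F (take i w) \<otimes> letter_value (w ! i) \<in> K"
      | "w ! i = inv_letter a" "word_value F (take i w) \<in> K"
      by (auto simp: crosses_def)
    then show False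
    proof cases
      case 1
      then have "word_value F (take (Suc i) w) \<in> K"
        using li by (simp add: S val_append word_value_Cons)
      then show False using take_in_K[OF Suc.prems] by simp
    next
      case 2
      then have "i = 0" using take_in_K[OF i] by blast
      then have "hd w = inv_letter (last w)" using 2(1) w_nonempty by (simp add: hd_conv_nth a_def)
      with hd_w show False by blast
    qed
  qed
  then show ?case using Suc.IH i li by (simp add: S avoids_append)
qed simp

lemma avoids_butlast: "avoids \<one> (butlast w)"
  using avoids_take[of "length w - 1"] w_nonempty by (simp add: butlast_conv_take)

lemma not_avoids_w:
  assumes "fst ` set z \<subseteq> X"
  shows "\<not> avoids \<one> (w @ z)"
proof -
  have "crosses (word_value F (butlast w)) a" using u_in_K by (simp add: crosses_def flip: u_eq)
  then have "\<not> avoids \<one> (butlast w @ (a # z))" using assms by (simp add: avoids_append)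
  also have "butlast w @ (a # z) = w @ z" by (subst (2) w_split) simp
  finally show ?thesis .
qed

lemma not_avoids_inv_a: "\<not> avoids \<one> (inv_letter a # z)"
  by (simp add: crosses_def)

lemma avoidingD:
  assumes "g \<in> avoiding"
  shows "g \<in> K" "g \<in> carrier F" "avoids \<one> (nf g)" "\<not> prefix w (nf g)" "\<not> prefix [inv_letter a] (nf g)"
proof -
  show 1: "g \<in> K" "g \<in> carrier F" "avoids \<one> (nf g)"
    using assms by (auto simp: avoiding_def)
  show "\<not> prefix w (nf g)"
  proof
    assume "prefix w (nf g)"
    then obtain z where z: "nf g = w @ z" by (auto simp: prefix_def)
    then have "fst ` set z \<subseteq> X" using nf_letters[OF 1(2)] by auto
    with not_avoids_w 1(3) z show False by simp
  qed
  show "\<not> prefix [inv_letter a] (nf g)"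
    using 1(3) not_avoids_inv_a by (auto simp: prefix_def)
qed

lemma avoiding_pong: "avoiding \<inter> pong = {}"
  using avoidingD(4,5) by (auto simp: pong_def)

lemma avoidingI:
  assumes "fst ` set z \<subseteq> X" "avoids \<one> z" "word_value F z \<in> K"
  shows "word_value F z \<in> avoiding"
  using assms avoids_nf by (simp add: avoiding_def)

lemma subgroup_avoiding: "subgroup avoiding F"
proof (rule subgroupI)
  show "avoiding \<subseteq> carrier F" using avoidingD(2) by blast
  have "\<one> \<in> avoiding" by (simp add: avoiding_def)
  then show "avoiding \<noteq> {}" by blast
next
  fix g assume g: "g \<in> avoiding"
  note gD = avoidingD[OF g]
  have "avoids (\<one> \<otimes> word_value F (nf g)) (inv_word (nf g))"
    using gD by (subst avoids_inv_word) (simp_all add: nf_letters)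
  then have "avoids \<one> (nf (inv g))"
    using gD(1,2) avoids_K[of g "inv_word (nf g)"] by (simp add: nf_inv nf_letters)
  then show "inv g \<in> avoiding" using gD by (simp add: avoiding_def)
next
  fix g h assume "g \<in> avoiding" "h \<in> avoiding"
  note gD = avoidingD[OF this(1)] and hD = avoidingD[OF this(2)]
  have "avoids \<one> (nf g @ nf h)"
    using gD hD avoids_K[of g "nf h"] by (simp add: avoids_append nf_letters)
  moreover have "word_value F (nf g @ nf h) = g \<otimes> h" using gD hD by (simp add: val_append nf_letters)
  ultimately show "g \<otimes> h \<in> avoiding"
    using avoidingI[of "nf g @ nf h"] gD hD by (simp add: nf_letters image_Un)
qed

text \<open>A loop is read letter by letter: \<open>y\<close> is an avoiding path from
  \<open>K\<close> to the current vertex and \<open>z\<close> the unread rest. Each crossing of the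
  edge is traded for a factor u or u^-1 and the detour along \<open>butlast w\<close>.\<close>

lemma K_subset_generate: "K \<subseteq> generate F (range (\<lambda>t::int. u [^] t) \<union> avoiding)"
proof -
  let ?P = "generate F (range (\<lambda>t::int. u [^] t) \<union> avoiding)"
  have "u = u [^] (1::int)" "inv u = u [^] (- 1 :: int)" by (simp_all add: int_pow_neg)
  then have "u \<in> range (\<lambda>t::int. u [^] t)" "inv u \<in> range (\<lambda>t::int. u [^] t)" by blast+
  then have uP: "u \<in> ?P" "inv u \<in> ?P" by (auto intro: generate.incl)
  have BP: "g \<in> ?P" if "g \<in> avoiding" for g using that by (auto intro: generate.incl)
  let ?w' = "word_value F (butlast w)"
  have w': "?w' \<in> carrier F" by simp
  have step: "word_value F y \<otimes> word_value F z \<in> ?P"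
    if "fst ` set y \<subseteq> X" "fst ` set z \<subseteq> X" "avoids \<one> y" "word_value F y \<otimes> word_value F z \<in> K" for y z
    using that
  proof (induction z arbitrary: y)
    case Nil
    then show ?case using BP[OF avoidingI[of y]] by simp
  next
    case (Cons l z)
    let ?y = "word_value F y" and ?l = "letter_value l" and ?z = "word_value F z"
    have l: "fst l \<in> X" and z: "fst ` set z \<subseteq> X" using Cons.prems by auto
    have cl: "?y \<in> carrier F" "?l \<in> carrier F" "?z \<in> carrier F" using Cons.prems l z by simp_all
    have eq: "?y \<otimes> word_value F (l # z) = ?y \<otimes> ?l \<otimes> ?z" using cl by (simp add: word_value_Cons m_assoc)
    consider "\<not> crosses ?y l" | "l = a" "?y \<otimes> ?l \<in> K" | "l = inv_letter a" "?y \<in> K"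
      by (auto simp: crosses_def)
    then show ?case
    proof cases
      case 1
      have "word_value F (y @ [l]) \<otimes> ?z \<in> ?P"
        by (rule Cons.IH)
          (use 1 Cons.prems l z eq in \<open>simp_all add: avoids_append val_append word_value_Cons\<close>)
      then show ?thesis using Cons.prems l eq by (simp add: val_append word_value_Cons)
    next
      case 2
      \<comment> \<open>Forward crossing: y a = (y w'^-1) u, where y followed by the reverse of
        \<open>butlast w\<close> is an avoiding loop. Reading restarts at \<open>K\<close> with an
        empty \<open>y\<close>.\<close>
      have "?y \<otimes> inv ?w' = word_value F (y @ inv_word (butlast w))"
        using Cons.prems by (simp add: val_append val_inv_word)
      also have "\<dots> \<in> avoiding"
      proof (rule avoidingI)
        have y: "?y \<otimes> inv ?w' = (?y \<otimes> ?l) \<otimes> inv u"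
          using cl 2(1) by (simp add: u_eq inv_mult_group m_assoc) (simp flip: m_assoc)
        then have yK: "?y \<otimes> inv ?w' \<in> K" using 2(2) u_in_K by simp
        then show "word_value F (y @ inv_word (butlast w)) \<in> K"
          using Cons.prems by (simp add: val_append val_inv_word)
        have "avoids ((?y \<otimes> inv ?w') \<otimes> ?w') (inv_word (butlast w))"
          using avoids_left[OF yK w', of "inv_word (butlast w)"]
            avoids_inv_word[of \<one> "butlast w"] avoids_butlast by simp
        then show "avoids \<one> (y @ inv_word (butlast w))"
          using Cons.prems cl by (simp add: avoids_append m_assoc)
      qed (use Cons.prems in \<open>simp add: image_Un\<close>)
      finally have "?y \<otimes> inv ?w' \<otimes> u \<in> ?P" using BP generate.eng[OF _ uP(1)] by blast
      moreover have yl: "?y \<otimes> inv ?w' \<otimes> u = ?y \<otimes> ?l"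
        using cl 2(1) by (simp add: u_eq m_assoc) (simp flip: m_assoc)
      moreover have "word_value F [] \<otimes> ?z \<in> ?P"
      proof (rule Cons.IH)
        have "?y \<otimes> ?l \<otimes> ?z \<in> K" using Cons.prems eq by simp
        then show "word_value F [] \<otimes> ?z \<in> K" using K_mult_left_iff[OF 2(2)] cl by simp
      qed (use z in simp_all)
      then have "?z \<in> ?P" using cl by simp
      ultimately show ?thesis unfolding eq by (simp only: generate.eng)
    next
      case 3
      \<comment> \<open>Backward crossing: y is itself an avoiding loop, and a^-1 = u^-1 w'. Reading
        resumes with \<open>butlast w\<close> as the new \<open>y\<close>.\<close>
      have y: "?y \<in> ?P" using BP avoidingI Cons.prems 3(2) by simp
      have lu: "inv u \<otimes> ?w' = ?l"
        using 3(1) basis_subset letters(1)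
        by (simp add: u_eq inv_mult_group m_assoc letter_value_inv_letter subsetD[OF basis_subset])
      have "?w' \<otimes> ?z \<in> ?P"
      proof (rule Cons.IH)
        have "?y \<otimes> (?l \<otimes> ?z) \<in> K" using Cons.prems by (simp add: word_value_Cons)
        then have "?l \<otimes> ?z \<in> K" using K_mult_left_iff[OF 3(2)] cl by simp
        then have "u \<otimes> (?l \<otimes> ?z) \<in> K" using u_in_K by simp
        also have "u \<otimes> (?l \<otimes> ?z) = ?w' \<otimes> ?z"
          using cl unfolding lu[symmetric] by (simp add: m_assoc) (simp flip: m_assoc)
        finally show "?w' \<otimes> ?z \<in> K" .
      qed (use z avoids_butlast in simp_all)
      then have "?y \<otimes> (inv u \<otimes> (?w' \<otimes> ?z)) \<in> ?P" by (rule generate.eng[OF y generate.eng[OF uP(2)]])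
      also have "inv u \<otimes> (?w' \<otimes> ?z) = ?l \<otimes> ?z" using cl by (simp flip: m_assoc add: lu)
      finally show ?thesis by (simp add: word_value_Cons)
    qed
  qed
  show ?thesis
  proof
    fix g assume g: "g \<in> K"
    then have "g \<in> carrier F" by simp
    then show "g \<in> ?P" using step[of "[]" "nf g"] g by (simp add: nf_letters)
  qed
qed

lemma generate_eq_K: "generate F (range (\<lambda>t::int. u [^] t) \<union> avoiding) = K"
proof
  have "u [^] t \<in> K" for t :: int
    using subgroup_int_pow_closed[OF K u_in_K] .
  then have "range (\<lambda>t::int. u [^] t) \<union> avoiding \<subseteq> K" using avoidingD(1) by blast
  then show "generate F (range (\<lambda>t::int. u [^] t) \<union> avoiding) \<subseteq> K"
    using K by (rule generate_subgroup_incl)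
qed (rule K_subset_generate)

section \<open>Ping-pong on the beginnings of normal forms\<close>

lemma pong_cyclic_pos:
  assumes g: "g \<in> carrier F" "g \<notin> pong"
  shows "prefix w (nf (u [^] Suc k \<otimes> g))"
proof (induction k)
  case 0
  have "w @ nf g \<in> reduced_words X"
    using g nf_reduced[OF g(1)] w_reduced
    by (subst reduced_words_append) (cases "nf g", auto simp: pong_def a_def)
  then have "nf (word_value F (w @ nf g)) = w @ nf g" by simp
  moreover have "word_value F (w @ nf g) = u \<otimes> g"
    using g w_letters by (simp add: val_append nf_letters u_def)
  ultimately show ?case by simp
next
  case (Suc k)
  let ?h = "u [^] Suc k \<otimes> g"
  obtain z where z: "nf ?h = w @ z" using Suc by (auto simp: prefix_def)
  have h: "?h \<in> carrier F" using g by simp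
  have "w @ z \<in> reduced_words X" using nf_reduced[OF h] z by simp
  then have "w @ nf ?h \<in> reduced_words X"
    unfolding z using ww w_nonempty by (simp add: reduced_words_append)
  then have "nf (word_value F (w @ nf ?h)) = w @ nf ?h" by simp
  moreover have "word_value F (w @ nf ?h) = u \<otimes> ?h"
    using h w_letters by (simp add: val_append nf_letters u_def del: nat_pow_Suc)
  moreover have "u \<otimes> ?h = u [^] Suc (Suc k) \<otimes> g"
    using g unfolding nat_pow_Suc2[OF u_closed, of "Suc k"] by (simp add: m_assoc del: nat_pow_Suc)
  ultimately show ?case by (metis prefixI)
qed

lemma pong_cyclic_neg:
  assumes g: "g \<in> carrier F" "g \<notin> pong"
  shows "prefix [inv_letter a] (nf (inv u [^] Suc k \<otimes> g))"
proof (induction k)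
  case 0
  have iw: "inv_word w = inv_letter a # inv_word (butlast w)" by (subst w_split) simp
  obtain b c d where bcd: "inv_word w = b @ c" "nf g = inv_word c @ d" "nf (inv u \<otimes> g) = b @ d"
    using nf_mult_cancel[of "inv u" g] g by (metis inv_closed nf_inv nf_u u_closed)
  have "b \<noteq> []"
  proof
    assume "b = []"
    then have "inv_word c = w" using bcd(1) by (metis append_Nil inv_word_simps(4))
    then show False using bcd(2) g(2) by (auto simp: pong_def)
  qed
  then show ?case using bcd iw g by (cases b) auto
next
  case (Suc k)
  let ?h = "inv u [^] Suc k \<otimes> g"
  obtain z where z: "nf ?h = inv_letter a # z" using Suc by (auto simp: prefix_def)
  have h: "?h \<in> carrier F" using g by simp
  have iw: "inv_word w = inv_letter a # inv_word (butlast w)" by (subst w_split) simp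
  have "last (inv_word w) = inv_letter (hd w)"
    using w_nonempty by (simp add: inv_word_def last_rev hd_map)
  then have "hd (nf ?h) \<noteq> inv_letter (last (inv_word w))"
    using hd_w unfolding z by (simp add: a_def)
  then have "inv_word w @ nf ?h \<in> reduced_words X"
    unfolding reduced_words_append
    using reduced_words_inv_word[OF w_reduced] nf_reduced[OF h] by blast
  then have "nf (word_value F (inv_word w @ nf ?h)) = inv_word w @ nf ?h" by simp
  moreover have "word_value F (inv_word w @ nf ?h) = inv u \<otimes> ?h"
    using h w_letters by (simp add: val_append nf_letters val_inv_word u_def del: nat_pow_Suc)
  moreover have "inv u \<otimes> ?h = inv u [^] Suc (Suc k) \<otimes> g"
    using g unfolding nat_pow_Suc2[OF inv_closed[OF u_closed], of "Suc k"]
    by (simp add: m_assoc del: nat_pow_Suc)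
  ultimately show ?case by (simp add: iw)
qed

lemma pong_cyclic:
  assumes "t \<noteq> 0" "g \<in> carrier F" "g \<notin> pong"
  shows "u [^] (t::int) \<otimes> g \<in> pong"
proof (cases t rule: int_cases3)
  case (pos k)
  then obtain j where "k = Suc j" by (metis gr0_implies_Suc)
  then show ?thesis using pong_cyclic_pos[OF assms(2,3), of j]
    by (simp add: pong_def pos int_pow_int del: nat_pow_Suc of_nat_Suc)
next
  case (neg k)
  then obtain j where "k = Suc j" by (metis gr0_implies_Suc)
  then have "u [^] t = inv u [^] Suc j"
    by (simp only: neg int_pow_neg_int[OF u_closed] nat_pow_inv[OF u_closed])
  then show ?thesis using pong_cyclic_neg[OF assms(2,3), of j]
    by (simp add: pong_def del: nat_pow_Suc)
qed (use assms in simp)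

text \<open>Let nf b = p c and nf g = c^-1 q. If g and b g were both in \<open>pong\<close>, then p
  and c^-1 would be proper prefixes of \<open>w\<close>, with c empty if g begins with the inverse
  of \<open>a\<close>. So b, an element of \<open>K\<close>, would be a quotient of two such
  prefixes, and distinctness of their cosets gives b = 1.\<close>

lemma pong_avoiding:
  assumes b: "b \<in> avoiding" "b \<noteq> \<one>" and g: "g \<in> carrier F" "g \<in> pong"
  shows "b \<otimes> g \<notin> pong"
proof
  assume bg: "b \<otimes> g \<in> pong"
  note bD = avoidingD[OF b(1)]
  obtain p c q where pcq: "nf b = p @ c" "nf g = inv_word c @ q" "nf (b \<otimes> g) = p @ q"
    using nf_mult_cancel[OF bD(2) g(1)] by blast
  have pX: "fst ` set p \<subseteq> X" and cX: "fst ` set c \<subseteq> X"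
    using nf_letters[OF bD(2)] by (auto simp: pcq(1))
  have b_val: "b = word_value F p \<otimes> word_value F c"
    using word_value_nf[OF bD(2)] pX cX by (simp add: pcq(1) val_append)
  have hd_p: "\<not> prefix [inv_letter a] p" "\<not> prefix w p"
    using bD(4,5) by (auto simp: pcq(1))
  \<comment> \<open>The path of b ends at \<open>K\<close>, so a final letter \<open>a\<close> would
    cross the forbidden edge.\<close>
  have no_end: "\<not> suffix [a] c"
  proof
    assume "suffix [a] c"
    then obtain c' where c': "c = c' @ [a]" by (auto simp: suffix_def)
    let ?s = "word_value F (p @ c')"
    have "b = ?s \<otimes> letter_value a" using b_val pX cX by (simp add: c' val_append word_value_Cons m_assoc)
    then have "crosses ?s a" using bD(1) by (simp add: crosses_def)
    moreover have "avoids \<one> ((p @ c') @ [a])" using bD(3) by (simp add: pcq(1) c')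
    ultimately show False using pX cX by (subst (asm) avoids_append) (auto simp: c' image_Un)
  qed
  \<comment> \<open>Otherwise the path of b would end with \<open>w\<close> run backwards, which
    starts at \<open>K\<close> with the inverse of \<open>a\<close>: again a crossing.\<close>
  have no_w: "\<not> prefix w (inv_word c)"
  proof
    assume "prefix w (inv_word c)"
    then obtain y where "inv_word c = w @ y" by (auto simp: prefix_def)
    then have c: "c = inv_word y @ inv_word w" by (metis inv_word_simps(2,4))
    have yX: "fst ` set (inv_word y) \<subseteq> X" using cX by (simp add: c image_Un)
    let ?s = "word_value F (p @ inv_word y)"
    have "b = ?s \<otimes> inv u"
      using b_val pX cX yX w_letters by (simp add: c val_append val_inv_word u_def m_assoc)
    then have "?s = b \<otimes> u" using pX yX by (simp add: m_assoc image_Un)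
    then have s: "?s \<in> K" using bD(1) u_in_K by simp
    have "inv_word w = inv_letter a # inv_word (butlast w)" by (subst w_split) simp
    then have "avoids \<one> ((p @ inv_word y) @ (inv_letter a # inv_word (butlast w)))"
      using bD(3) by (simp add: pcq(1) c)
    moreover have "fst ` set (p @ inv_word y) \<subseteq> X" using pX yX by (simp add: image_Un)
    moreover from this have "?s \<in> carrier F" by (rule val_closed)
    ultimately have "avoids ?s (inv_letter a # inv_word (butlast w))"
      using avoids_append[of \<one> "p @ inv_word y" "inv_letter a # inv_word (butlast w)"] by simp
    with s show False by (simp add: crosses_def)
  qed
  from g(2) have "prefix [inv_letter a] (nf g) \<or> prefix w (nf g)" by (auto simp: pong_def)
  then show False
  proof
    assume pg: "prefix [inv_letter a] (nf g)"
    have c: "c = []"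
    proof (rule ccontr)
      assume "c \<noteq> []"
      then obtain c' l where c': "c = c' @ [l]" by (metis rev_exhaust)
      then have "l = a" using pg by (auto simp: pcq(2) inv_letter_eq_iff)
      with no_end c' show False by (simp add: suffix_def)
    qed
    then have "b = word_value F p" "p \<noteq> []" using b_val b(2) pX by auto
    then have pK: "word_value F p \<in> K" using bD(1) by simp
    from bg \<open>p \<noteq> []\<close> hd_p(1) have "prefix w (p @ q)" by (cases p) (auto simp: pong_def pcq(3))
    then have "prefix p w" using hd_p(2) prefix_same_cases[of w "p @ q" p] by auto
    then have "p = take (length p) w" "length p < length w"
      using hd_p(2) prefix_length_less[of p w] by (auto simp: prefix_def strict_prefix_def)
    then have "length p = 0" using take_in_K[of "length p"] pK by simp
    with \<open>p \<noteq> []\<close> show False by simp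
  next
    assume "prefix w (nf g)"
    then have "prefix (inv_word c) w" using no_w prefix_same_cases[of w "nf g" "inv_word c"]
      by (auto simp: pcq(2))
    then have cw: "inv_word c = take (length c) w" "length c < length w"
      using no_w prefix_length_less[of "inv_word c" w] by (auto simp: prefix_def strict_prefix_def)
    define k where "k = length c"
    have k: "inv_word c = take k w" "k < length w" using cw by (simp_all add: k_def)
    have "inv (word_value F c) = word_value F (take k w)"
      unfolding k(1)[symmetric] by (rule val_inv_word[OF cX, symmetric])
    then have "word_value F c = inv (word_value F (take k w))" using cX by (metis inv_inv val_closed)
    then have b_eq: "b = word_value F p \<otimes> inv (word_value F (take k w))" using b_val by simp
    have "p \<noteq> []"
    proof
      assume "p = []"
      then have "word_value F (take k w) = inv b" using b_eq by simp
      then have "word_value F (take k w) \<in> K" using bD(1) by simp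
      then have "k = 0" using take_in_K k(2) by blast
      then show False using b_eq b(2) \<open>p = []\<close> by simp
    qed
    then have "prefix w (p @ q)" using bg hd_p(1) by (cases p) (auto simp: pong_def pcq(3))
    then have "prefix p w" using hd_p(2) prefix_same_cases[of w "p @ q" p] by auto
    then have p: "p = take (length p) w" "length p < length w"
      using hd_p(2) prefix_length_less[of p w] by (auto simp: prefix_def strict_prefix_def)
    have "length p = k"
      using prefixes_distinct[OF p(2) k(2)] bD(1) b_eq p(1) by auto
    then have "b = \<one>" using b_eq p(1) pX by (metis r_inv val_closed)
    with b(2) show False by blast
  qed
qed

theorem free_factor_cyclic: "free_factor (F\<lparr>carrier := K\<rparr>) (range (\<lambda>t::int. u [^] t))"
proof -
  have "subgroup (range (\<lambda>t::int. u [^] t)) F"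
    using int_pow_mult[OF u_closed, symmetric] int_pow_neg[OF u_closed, symmetric]
    by (intro subgroupI) auto
  then have "internal_free_product
      (F\<lparr>carrier := generate F (range (\<lambda>t::int. u [^] t) \<union> avoiding)\<rparr>) (range (\<lambda>t::int. u [^] t)) avoiding"
  proof (rule ping_pong[where S = pong, OF _ subgroup_avoiding])
    show "h \<otimes> g \<in> pong" if h: "h \<in> range (\<lambda>t::int. u [^] t) - {\<one>}" and g: "g \<in> carrier F - pong" for h g
    proof -
      obtain t :: int where t: "h = u [^] t" using h by blast
      then have "t \<noteq> 0" using h by (intro notI) simp
      then show ?thesis using pong_cyclic g t by simp
    qed
    show "b \<otimes> g \<notin> pong" if "b \<in> avoiding - {\<one>}" "g \<in> carrier F \<inter> pong" for b g
      using pong_avoiding that by simp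
  qed (rule avoiding_pong)
  then show ?thesis unfolding generate_eq_K free_factor_def by blast
qed

end

section \<open>Cyclic subgroups are closed free factors of clopen subgroups\<close>

text \<open>The right side is spelled by a prefix of w^(k+2), which is reduced and has at least the
  length of \<open>w\<close>; the left side is shorter.\<close>

lemma (in cyclically_reduced) take_neq_pow_mult_take:
  assumes "i < length w"
  shows "word_value F (take i w) \<noteq> u [^] Suc k \<otimes> word_value F (take j w)"
proof
  assume eq: "word_value F (take i w) = u [^] Suc k \<otimes> word_value F (take j w)"
  let ?W = "concat (replicate (Suc k) w)"
  have "?W @ w = concat (replicate (Suc (Suc k)) w)"
    by (simp only: replicate_append_same[symmetric] replicate_Suc[of "Suc k"] concat_append) simp
  then have "(?W @ take j w) @ drop j w \<in> reduced_words X"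
    using concat_replicate_reduced[of "Suc (Suc k)"] by simp
  then have red: "?W @ take j w \<in> reduced_words X"
    using reduced_words_append[of "?W @ take j w"] by blast
  have "take i w @ drop i w \<in> reduced_words X" using w_reduced by simp
  then have red_i: "take i w \<in> reduced_words X" using reduced_words_append by blast
  have "fst ` set ?W \<subseteq> X" "fst ` set (take j w) \<subseteq> X"
    using reduced_words_subset[OF red] by (simp_all only: set_append image_Un Un_subset_iff)
  then have "word_value F (take i w) = word_value F (?W @ take j w)"
    unfolding eq u_pow_word by (simp only: val_append)
  then have "take i w = ?W @ take j w" using nf_word_value red red_i by metis
  then have "length (take i w) = length (?W @ take j w)" by (rule arg_cong)
  also have "\<dots> \<ge> length w" by (simp only: length_append length_concat_replicate) simp
  finally show False using assms by simp
qed

text \<open>This makes separability applicable to pairs of prefixes. A negative exponent is turned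
  positive by exchanging i and j.\<close>

lemma (in cyclically_reduced) prefix_quotient_notin:
  assumes "i < length w" "j < length w" "i \<noteq> j"
  shows "word_value F (take i w) \<otimes> inv (word_value F (take j w)) \<notin> range (\<lambda>t::int. u [^] t)"
proof
  let ?p = "word_value F (take i w)" and ?q = "word_value F (take j w)"
  have red: "take k w \<in> reduced_words X" for k
  proof -
    have "take k w @ drop k w \<in> reduced_words X" using w_reduced by simp
    then show ?thesis using reduced_words_append by blast
  qed
  then have c: "?p \<in> carrier F" "?q \<in> carrier F" by simp_all
  assume "?p \<otimes> inv ?q \<in> range (\<lambda>t::int. u [^] t)"
  then obtain t :: int where t: "?p \<otimes> inv ?q = u [^] t" by blast
  then have p: "?p = u [^] t \<otimes> ?q" using c inv_solve_right[of "u [^] t" ?p ?q] by simp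
  show False
  proof (cases t rule: int_cases3)
    case zero
    then have "?p = ?q" using p c by simp
    then have "take i w = take j w" using nf_word_value red by metis
    then have "length (take i w) = length (take j w)" by simp
    with assms show False by simp
  next
    case (pos n)
    then obtain k where k: "n = Suc k" by (metis gr0_implies_Suc)
    have "?p = u [^] Suc k \<otimes> ?q" using p unfolding pos k int_pow_int .
    then show False using take_neq_pow_mult_take assms(1) by blast
  next
    case (neg n)
    then obtain k where k: "n = Suc k" by (metis gr0_implies_Suc)
    have "?p = inv (u [^] Suc k) \<otimes> ?q"
      using p unfolding neg(1) k int_pow_neg_int[OF u_closed] .
    then have "?q = u [^] Suc k \<otimes> ?p"
      using c inv_solve_left[of ?p "u [^] Suc k" ?q] by (simp del: nat_pow_Suc)
    then show False using take_neq_pow_mult_take assms(2) by blast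
  qed
qed

section \<open>Clopen subgroups and the conclusion\<close>

lemma clopenin_pro_topology_vimage:
  assumes "pseudovariety V" "group G" "N \<in> V" "\<phi> \<in> hom G N"
  shows "openin (pro_topology V G) {x \<in> carrier G. \<phi> x \<in> U}"
    and "closedin (pro_topology V G) {x \<in> carrier G. \<phi> x \<in> U}"
proof -
  have op: "openin (pro_topology V G) {x \<in> carrier G. \<phi> x \<in> U}" for U
  proof -
    have "{x \<in> carrier G. \<phi> x \<in> U} = {x \<in> carrier G. \<phi> x \<in> U \<inter> carrier N}"
      using assms(4) by (auto simp: hom_def)
    moreover have "openin (discrete_topology (carrier N)) (U \<inter> carrier N)" by simp
    ultimately show ?thesis
      using assms(3,4) unfolding pro_topology_def by (intro topology_generated_by_Basis) blast
  qed
  show "openin (pro_topology V G) {x \<in> carrier G. \<phi> x \<in> U}" by (rule op)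
  have "carrier G - {x \<in> carrier G. \<phi> x \<in> U} = {x \<in> carrier G. \<phi> x \<in> - U}" by blast
  then show "closedin (pro_topology V G) {x \<in> carrier G. \<phi> x \<in> U}"
    using op[of "- U"] by (auto simp: closedin_def topspace_pro_topology assms(1,2))
qed

lemma (in group) subgroup_vimage:
  assumes "group N" "\<phi> \<in> hom G N" "subgroup H G"
  shows "subgroup {x \<in> carrier G. \<phi> x \<in> \<phi> ` H} G"
proof -
  interpret h: group_hom G N \<phi>
    using assms(1,2) by (simp add: group_hom_def group_hom_axioms_def group_axioms)
  have S: "subgroup (\<phi> ` H) N" by (rule h.subgroup_img_is_subgroup[OF assms(3)])
  show ?thesis
    by (rule subgroupI)
      (use subgroup.one_closed[OF S] subgroup.m_closed[OF S] subgroup.m_inv_closed[OF S] in \<open>auto intro!: exI[of _ \<one>]\<close>)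
qed

text \<open>\<open>K\<close> is the full preimage of the image of the cyclic subgroup. The unit is
  treated apart because it has no nonempty reduced spelling.\<close>

lemma (in based_free_group) cyclic_clopen_separation:
  assumes V: "pseudovariety V"
    and nilp: "\<And>N :: nat monoid. nilpotent_group N \<Longrightarrow> finite (carrier N) \<Longrightarrow> N \<in> V"
    and u: "u \<in> carrier F" and g: "g \<in> carrier F" "g \<notin> range (\<lambda>t::int. u [^] t)"
  obtains K where "subgroup K F" "openin (pro_topology V F) K" "closedin (pro_topology V F) K"
    "range (\<lambda>t::int. u [^] t) \<subseteq> K" "g \<notin> K"
proof -
  let ?H = "range (\<lambda>t::int. u [^] t)"
  have "\<exists>(N :: nat monoid) \<psi>. nilpotent_group N \<and> finite (carrier N) \<and> \<psi> \<in> hom F N \<and> \<psi> g \<notin> \<psi> ` ?H"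
  proof (cases "u = \<one>")
    case True
    then have H: "?H = {\<one>}" by auto
    then have "g \<noteq> \<one>" using g(2) by simp
    then obtain N :: "nat monoid" and \<psi> where N: "nilpotent_group N" "finite (carrier N)"
      "\<psi> \<in> hom F N" "\<psi> g \<noteq> \<one>\<^bsub>N\<^esub>"
      using residually_p[OF g(1) _ two_is_prime_nat] by metis
    moreover have "\<psi> \<one> = \<one>\<^bsub>N\<^esub>"
      using N hom_one[OF N(3)] group_axioms by (simp add: nilpotent_group_def)
    ultimately show ?thesis unfolding H by (intro exI[of _ N] exI[of _ \<psi>]) simp
  next
    case False
    obtain Y w where Yw: "based_free_group F Y" "w \<in> reduced_words Y" "word_value F w = u"
      "w \<noteq> []" "w @ w \<in> reduced_words Y"
      using cyclically_reduced_basis[OF based_free_group_axioms u False] by blast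
    interpret c: cyclically_reduced F Y w
      using Yw by (simp add: cyclically_reduced_def cyclically_reduced_axioms_def)
    have "c.u = u" by (simp add: c.u_def Yw)
    then show ?thesis using c.cyclic_subgroup_separable[of g] g by metis
  qed
  then obtain N :: "nat monoid" and \<psi> where N: "nilpotent_group N" "finite (carrier N)" "\<psi> \<in> hom F N"
    "\<psi> g \<notin> \<psi> ` ?H" by blast
  have "N \<in> V" using N nilp by blast
  note top = clopenin_pro_topology_vimage[OF V group_axioms this N(3), of "\<psi> ` ?H"]
  have "subgroup ?H F"
    using int_pow_mult[OF u, symmetric] int_pow_neg[OF u, symmetric] u by (intro subgroupI) auto
  then have "subgroup {x \<in> carrier F. \<psi> x \<in> \<psi> ` ?H} F"
    using N by (intro subgroup_vimage[where N = N]) (auto simp: nilpotent_group_def)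
  then show thesis using that top N(4) u by blast
qed

theorem corollary4p2:
  fixes V :: "nat monoid set" and F :: "'a monoid" and H :: "'a set"
  assumes "pseudovariety V"
    and "\<And>N :: nat monoid. nilpotent_group N \<Longrightarrow> finite (carrier N) \<Longrightarrow> N \<in> V"
    and "free_group F"
    and "subgroup H F"
    and "cyclic_group (F\<lparr>carrier := H\<rparr>)"
  shows "closedin (pro_topology V F) H \<and>
         (\<exists>K. subgroup K F \<and>
              closedin (pro_topology V F) K \<and> openin (pro_topology V F) K \<and>
              free_factor (F\<lparr>carrier := K\<rparr>) H)"
proof -
  interpret group F using assms(3) by (simp add: free_group_def)
  obtain X where "free_basis F X" using assms(3) by (auto simp: free_group_def)
  then interpret X: based_free_group F X by unfold_locales
  let ?T = "pro_topology V F"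
  have top: "topspace ?T = carrier F" by (rule topspace_pro_topology[OF assms(1) group_axioms])
  have whole: "openin ?T (carrier F)" "closedin ?T (carrier F)" "subgroup (carrier F) F"
    using top openin_topspace[of ?T] closedin_topspace[of ?T] subgroup_self by auto
  interpret H: group "F\<lparr>carrier := H\<rparr>"
    using assms(4) group_axioms by (rule subgroup.subgroup_is_group)
  obtain u where u: "u \<in> H" "H = range (\<lambda>t::int. u [^]\<^bsub>F\<lparr>carrier := H\<rparr>\<^esub> t)"
    using assms(5) unfolding H.cyclic_group by auto
  then have H: "H = range (\<lambda>t::int. u [^]\<^bsub>F\<^esub> t)"
    using int_pow_consistent[OF assms(4) u(1)] by simp
  have uc: "u \<in> carrier F" using assms(4) u(1) by (rule subgroup.mem_carrier)
  have sep: "\<exists>K. subgroup K F \<and> openin ?T K \<and> closedin ?T K \<and> H \<subseteq> K \<and> g \<notin> K"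
    if "g \<in> carrier F" "g \<notin> H" for g
    using X.cyclic_clopen_separation[OF assms(1,2) uc that[unfolded H]] unfolding H by metis
  have closed: "closedin ?T H"
  proof -
    \<comment> \<open>Every point outside \<open>H\<close> is omitted by a clopen subgroup
      containing \<open>H\<close>, so \<open>H\<close> is its own closure.\<close>
    have "H = \<Inter> {K. closedin ?T K \<and> H \<subseteq> K}"
    proof
      show "\<Inter> {K. closedin ?T K \<and> H \<subseteq> K} \<subseteq> H"
      proof
        fix g assume g: "g \<in> \<Inter> {K. closedin ?T K \<and> H \<subseteq> K}"
        then have "g \<in> carrier F" using whole(2) subgroup.subset[OF assms(4)] by blast
        then show "g \<in> H" using sep[of g] g by blast
      qed
    qed blast
    moreover have "closedin ?T (\<Inter> {K. closedin ?T K \<and> H \<subseteq> K})"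
      by (rule closedin_Inter) (use whole(2) subgroup.subset[OF assms(4)] in blast)+
    ultimately show ?thesis by simp
  qed
  have "\<exists>K. subgroup K F \<and> closedin ?T K \<and> openin ?T K \<and> free_factor (F\<lparr>carrier := K\<rparr>) H"
  proof (cases "u = \<one>\<^bsub>F\<^esub>")
    case True
    then have H1: "H = {\<one>\<^bsub>F\<^esub>}" using H by auto
    \<comment> \<open>With a trivial first factor and empty \<open>S\<close> there is nothing to
      play; the trivial subgroup is a free factor of \<open>F\<close> itself.\<close>
    have "internal_free_product (F\<lparr>carrier := generate F ({\<one>\<^bsub>F\<^esub>} \<union> carrier F)\<rparr>) {\<one>\<^bsub>F\<^esub>} (carrier F)"
      by (rule ping_pong[where S = "{}"]) (auto intro: triv_subgroup subgroup_self)
    moreover have "generate F ({\<one>\<^bsub>F\<^esub>} \<union> carrier F) = carrier F"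
      using generate_in_carrier[of "{\<one>\<^bsub>F\<^esub>} \<union> carrier F"] by (auto intro: generate.incl)
    ultimately have "free_factor (F\<lparr>carrier := carrier F\<rparr>) H"
      unfolding free_factor_def H1 by (metis (no_types))
    with whole show ?thesis by blast
  next
    case False
    obtain Y w where Yw: "based_free_group F Y" "w \<in> reduced_words Y" "word_value F w = u"
      "w \<noteq> []" "w @ w \<in> reduced_words Y"
      using cyclically_reduced_basis[OF X.based_free_group_axioms uc False] by blast
    interpret c: cyclically_reduced F Y w
      using Yw by (simp add: cyclically_reduced_def cyclically_reduced_axioms_def)
    have cu: "c.u = u" by (simp add: c.u_def Yw)
    define d where "d = (\<lambda>(i, j). word_value F (take i w) \<otimes>\<^bsub>F\<^esub> inv\<^bsub>F\<^esub> (word_value F (take j w)))"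
    define I where "I = {(i, j). i < length w \<and> j < length w \<and> i \<noteq> j}"
    have "finite I"
      by (rule finite_subset[of _ "{..<length w} \<times> {..<length w}"]) (auto simp: I_def)
    have "\<exists>K. subgroup K F \<and> openin ?T K \<and> closedin ?T K \<and> H \<subseteq> K \<and> d ij \<notin> K" if "ij \<in> I" for ij
    proof (rule sep)
      have "fst ` set (take i w) \<subseteq> Y" for i
        using c.w_letters set_take_subset[of i w] by blast
      then show "d ij \<in> carrier F" by (auto simp: d_def split: prod.split)
      show "d ij \<notin> H"
        using that c.prefix_quotient_notin unfolding H cu by (auto simp: d_def I_def)
    qed
    then obtain L where L: "\<And>ij. ij \<in> I \<Longrightarrow> subgroup (L ij) F \<and> openin ?T (L ij) \<and>
        closedin ?T (L ij) \<and> H \<subseteq> L ij \<and> d ij \<notin> L ij"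
      by metis
    \<comment> \<open>Finiteness of \<open>I\<close> keeps \<open>K\<close> open. Inserting the
      whole group covers the case of a one-letter \<open>w\<close>, for which \<open>I\<close> is
      empty.\<close>
    define K where "K = \<Inter> (insert (carrier F) (L ` I))"
    have K: "subgroup K F" "openin ?T K" "closedin ?T K"
    proof -
      show "subgroup K F" unfolding K_def by (rule subgroups_Inter) (use L whole in auto)
      show "openin ?T K" unfolding K_def
        by (rule openin_Inter) (use \<open>finite I\<close> L whole in auto)
      show "closedin ?T K" unfolding K_def by (rule closedin_Inter) (use L whole in auto)
    qed
    have "H \<subseteq> K" using L subgroup.subset[OF assms(4)] by (auto simp: K_def)
    interpret s: cycle_in_schreier_graph F Y w K
    proof (intro cycle_in_schreier_graph.intro cycle_in_schreier_graph_axioms.intro)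
      show "cyclically_reduced F Y w" by (rule c.cyclically_reduced_axioms)
      show "subgroup K F" by (rule K)
      show "c.u \<in> K" unfolding cu using \<open>H \<subseteq> K\<close> u(1) by blast
      show "word_value F (take i w) \<otimes>\<^bsub>F\<^esub> inv\<^bsub>F\<^esub> (word_value F (take j w)) \<notin> K"
        if "i < length w" "j < length w" "i \<noteq> j" for i j
        using L[of "(i, j)"] that by (auto simp: K_def I_def d_def)
    qed
    have "free_factor (F\<lparr>carrier := K\<rparr>) H"
      using s.free_factor_cyclic unfolding cu H[symmetric] .
    with K show ?thesis by blast
  qed
  with closed show ?thesis by blast
qed

end
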